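(* Let $X$ be a compact metric space, $m\in C(X,\mathbb{R}^{d\times d}_{\mathrm{psd}})$ and $M(\xi):=\int_X m(x)\,\mathrm{d}\xi(x)$ for $\xi\in\Xi(X)$. Let $\Psi:\mathbb{R}^{d\times d}_{\mathrm{psd}}\to\mathbb{R}\cup\{\infty\}$ be convex and lower semicontinuous with $\Xi_{\mathrm{fin}}(X)\ne\emptyset$, and suppose that $\Psi|_{\operatorname{dom}\Psi}$ is continuously differentiable and that $\operatorname{dom}\Psi$ is directionally open w.r.t. $M(\Xi(X))$. Suppose further that the set $\mathcal{A}:=\{m(x):x\in X\}$ of one-point information matrices is finite with $|\mathcal{A}|\ge2$, that $$\mathcal{M}:=M(\Xi(X))\subset\operatorname{dom}\Psi,$$ and that $\Psi|_{\mathcal{M}}$ is $\mu$-strongly convex and $L$-smooth w.r.t. $|\cdot|$ for some $\mu,L\in(0,\infty)$. Suppose finally that $X^0$ is a finite subset of $X$ with $\Xi_{\mathrm{fin}}(X^0)\neq\emptyset$ and that $(\xi^k)_{k\in K}$ is generated by the strict algorithm without exchange or by the strict algorithm with exchange, with initial discretization $X^0$ and optimality tolerances $\varepsilon\in[0,\infty)$ and $\overline{\delta}_k=0=\underline{\delta}_k$ for all $k$. Then $$\Psi(M(\xi^k))-\Psi^*\le r^k\cdot\big(\Psi(M(\xi^0))-\Psi^*\big)\qquad\text{for all }k\in K,$$ where $\Psi^*:=\min_{\xi\in\Xi(X)}\Psi(M(\xi))$, $r:=1-\min\{1/2,\ \mu_{\Psi,\mathcal{M}}/C_{\Psi,\mathcal{M}}\}$,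 and $$\frac12\le r\le1-\min\Big\{\frac12,\ \frac{\mu}{L}\Big(\frac{\operatorname{pwidth}(\mathcal{A})}{\operatorname{diam}(\mathcal{M})}\Big)^2\Big\}<1 .$$
   Context: Let $d\in\mathbb{N}$; $\mathbb{R}^{d\times d}_{\mathrm{psd}}$ is the set of (symmetric) positive semidefinite real $d\times d$ matrices; $|M|:=\operatorname{tr}(M^\top M)^{1/2}$ is the Frobenius norm. $\Xi(X)$ is the set of Borel probability measures (designs) on $X$; for a finite $X'\subset X$, $\Xi(X')$ is identified with the designs on $X$ supported in $X'$. $\operatorname{supp}\xi$ is the support of $\xi$. $\operatorname{dom}\Psi:=\{M:\Psi(M)<\infty\}$, and for $X'\subset X$, $\Xi_{\mathrm{fin}}(X'):=\{\xi\in\Xi(X'):\Psi(M(\xi))<\infty\}$. A real-valued function on an arbitrary subset $S$ of $\mathbb{R}^{d\times d}$ is called (continuously) differentiable iff it extends to a (continuously) Fréchet differentiable function $\tilde\Psi$ on an open set of $\mathbb{R}^{d\times d}$ containing $S$; one writes $D\Psi(M)E:=D\tilde\Psi(M)E$ for a fixed such extension (independent of the extension whenever $M+tE\in S$ for all small $t\ge0$). $\operatorname{dom}\Psi$ is directionally open w.r.t. $M(\Xi(X))$ iff for every $M\in\operatorname{dom}\Psi$ and $\eta\in\Xi(X)$ there is $t^*\in(0,1]$ with $M+t(M(\eta)-M)\in\operatorname{dom}\Psi$ for all $t\in[0,t^*]$. For a convex set $C$, a differentiable $\Psi:C\to\mathbb{R}$ is $L$-smooth, resp. $\mu$-strongly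 convex, w.r.t. $|\cdot|$ iff $\Psi(N)-\Psi(M)-D\Psi(M)(N-M)$ is $\le\frac L2|N-M|^2$, resp. $\ge\frac\mu2|N-M|^2$, for all $M,N\in C$. The sensitivity function is $\psi(M,x):=D\Psi(M)(m(x)-M)$ for $M\in\operatorname{dom}\Psi$, $x\in X$. A $\delta$-approximate solution of a minimization problem is a feasible point whose objective value is at most the infimum plus $\delta$. Strict algorithms. Input: finite $X^0\subset X$, tolerances $\varepsilon,\overline{\delta}_k,\underline{\delta}_k\in[0,\infty)$ ($k\in\mathbb{N}_0$). Start with $k=0$. Step 1: compute a $\overline{\delta}_k$-approximate solution $\xi^k\in\Xi(X^k)$ of $\min_{\xi\in\Xi(X^k)}\Psi(M(\xi))$. Step 2: compute a $\underline{\delta}_k$-approximate solution $x^k\in X$ of $\min_{x\in X}\psi(M(\xi^k),x)$. If $\psi(M(\xi^k),x^k)<-\varepsilon+\underline{\delta}_k$, set $X^{k+1}:=X^k\cup\{x^k\}$ (algorithm without exchange) or $X^{k+1}:=\operatorname{supp}\xi^k\cup\{x^k\}$ (algorithm with exchange) and return to Step 1 with $k+1$ in place of $k$; if $\psi(M(\xi^k),x^k)\ge-\varepsilon+\underline{\delta}_k$, terminate. $K$ is the set of iteration indices: $K=\{0,\dots,k^*\}$ if the algorithm terminates in iteration $k^*$, and $K=\mathbb{N}_0$ otherwise. Constants. Here $\mathcal{M}=M(\Xi(X))=\operatorname{conv}(\mathcal{A})$. For $M\in\mathcal{M}$, a subset $\mathcal{S}\subset\mathcal{A}$ is active for $M$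 iff $M=\sum_{n\in\mathcal{S}}\lambda_n n$ with all $\lambda_n>0$ and $\sum_{n\in\mathcal{S}}\lambda_n=1$; $\mathcal{S}_{\mathcal{A}}(M)$ is the set of all such $\mathcal{S}$. Let $\mathcal{M}_M:=\operatorname{argmin}_{a\in\mathcal{A}}D\Psi(M)a$ and $\mathcal{N}_{M,\mathcal{S}}:=\operatorname{argmax}_{n\in\mathcal{S}}D\Psi(M)n$, and let $\mathcal{N}_M$ be the set of minimizers of $n\mapsto D\Psi(M)n$ over $\bigcup_{\mathcal{S}\in\mathcal{S}_{\mathcal{A}}(M)}\mathcal{N}_{M,\mathcal{S}}$. For $M,M'\in\mathcal{M}$ with $D\Psi(M)(M'-M)<0$ set $\alpha(M,M'):=D\Psi(M)(M'-M)/D\Psi(M)(m_M-n_M)$ with arbitrary $m_M\in\mathcal{M}_M$, $n_M\in\mathcal{N}_M$ (this is well defined and positive). Then $$\mu_{\Psi,\mathcal{M}}:=\inf_{M,M'\in\mathcal{M},\,D\Psi(M)(M'-M)<0}\frac{2}{\alpha(M,M')^2}\big(\Psi(M')-\Psi(M)-D\Psi(M)(M'-M)\big),$$ $$C_{\Psi,\mathcal{M}}:=\sup_{M,M'\in\mathcal{M},\,\alpha\in(0,1]}\frac{2}{\alpha^2}\big(\Psi(M+\alpha(M'-M))-\Psi(M)-\alpha D\Psi(M)(M'-M)\big).$$ The pyramidal width of $\mathcal{A}$ is $\operatorname{pwidth}(\mathcal{A}):=\min_{\mathcal{F}}\operatorname{dist}(\mathcal{F},\operatorname{conv}(\mathcal{A}\setminus\mathcal{F}))$,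 the minimum over all faces $\mathcal{F}$ of the polytope $\operatorname{conv}(\mathcal{A})$ with $\emptyset\ne\mathcal{F}\ne\operatorname{conv}(\mathcal{A})$, with distance in the Frobenius norm. Finally $\operatorname{diam}(\mathcal{M}):=\sup\{|M-N|:M,N\in\mathcal{M}\}$. *)

theory Defs
  imports "HOL-Analysis.Analysis" "HOL-Probability.Probability"
begin

definition psd_matrices :: "(real ^ 'd ^ 'd) set" where
  "psd_matrices = {M. transpose M = M \<and> (\<forall>v. 0 \<le> v \<bullet> (M *v v))}"

text \<open>The library norm on real matrices is the Frobenius norm, so \<open>norm\<close>, \<open>diameter\<close> and
  \<open>setdist\<close> below all refer to it.\<close>

lemma norm_matrix_eq_frobenius:
  fixes M :: "real ^ 'd ^ 'd"
  shows "norm M = sqrt (trace (transpose M ** M))"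
proof -
  have "(\<Sum>i\<in>UNIV. \<Sum>j\<in>UNIV. (M $ i $ j)\<^sup>2) = (\<Sum>j\<in>UNIV. \<Sum>i\<in>UNIV. (M $ i $ j)\<^sup>2)"
    by (rule sum.swap)
  then show ?thesis
    by (simp add: norm_vec_def L2_set_def trace_def transpose_def matrix_matrix_mult_def
        sum_nonneg power2_eq_square)
qed


section \<open>Extended-real-valued functions\<close>

text \<open>Only the values on the set \<open>S\<close> matter, for a function that is mathematically defined on
  \<open>S\<close> alone.\<close>

definition eff_dom :: "'a set \<Rightarrow> ('a \<Rightarrow> ereal) \<Rightarrow> 'a set" where
  "eff_dom S F = {M \<in> S. F M < \<infinity>}"

definition ereal_convex_on :: "'a::real_vector set \<Rightarrow> ('a \<Rightarrow> ereal) \<Rightarrow> bool" where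
  "ereal_convex_on S F \<longleftrightarrow>
     (\<forall>M\<in>S. \<forall>N\<in>S. \<forall>t\<in>{0..1}.
        F ((1 - t) *\<^sub>R M + t *\<^sub>R N) \<le> ereal (1 - t) * F M + ereal t * F N)"

definition lsc_on :: "'a::topological_space set \<Rightarrow> ('a \<Rightarrow> ereal) \<Rightarrow> bool" where
  "lsc_on S F \<longleftrightarrow> (\<forall>M\<in>S. \<forall>a<F M. \<forall>\<^sub>F N in at M within S. a < F N)"

definition directionally_open :: "'a::real_vector set \<Rightarrow> 'a set \<Rightarrow> bool" where
  "directionally_open S C \<longleftrightarrow>
     (\<forall>M\<in>S. \<forall>N\<in>C. \<exists>t0\<in>{0<..1}. \<forall>t\<in>{0..t0}. M + t *\<^sub>R (N - M) \<in> S)"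

definition approx_solution :: "real \<Rightarrow> 'a set \<Rightarrow> ('a \<Rightarrow> ereal) \<Rightarrow> 'a \<Rightarrow> bool" where
  "approx_solution \<delta> S F x \<longleftrightarrow> x \<in> S \<and> F x \<le> (INF y\<in>S. F y) + ereal \<delta>"


section \<open>Differentiability on arbitrary sets\<close>

text \<open>\<open>g\<close>, with derivative \<open>D\<close>, is a continuously Frechet differentiable extension of
  \<open>f\<close> from the arbitrary set \<open>S\<close> to the open set \<open>U\<close>. A function \<open>f\<close> on \<open>S\<close> is continuously
  differentiable iff such \<open>U\<close>, \<open>g\<close>, \<open>D\<close> exist, and its derivative is \<open>D\<close> for a fixed choice of them.\<close>

definition C1_extension ::
  "'a::real_normed_vector set \<Rightarrow> ('a \<Rightarrow> real) \<Rightarrow> 'a set \<Rightarrow> ('a \<Rightarrow> real) \<Rightarrow> ('a \<Rightarrow> 'a \<Rightarrow>\<^sub>L real) \<Rightarrow> bool"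
where
  "C1_extension S f U g D \<longleftrightarrow>
     open U \<and> S \<subseteq> U \<and> (\<forall>M\<in>S. g M = f M) \<and>
     (\<forall>M\<in>U. (g has_derivative blinfun_apply (D M)) (at M)) \<and> continuous_on U D"

definition smooth_wrt ::
  "'a::real_normed_vector set \<Rightarrow> ('a \<Rightarrow> real) \<Rightarrow> ('a \<Rightarrow> 'a \<Rightarrow>\<^sub>L real) \<Rightarrow> real \<Rightarrow> bool" where
  "smooth_wrt C f D L \<longleftrightarrow>
     (\<forall>M\<in>C. \<forall>N\<in>C. f N - f M - blinfun_apply (D M) (N - M) \<le> L / 2 * (norm (N - M))\<^sup>2)"

definition strongly_convex_wrt ::
  "'a::real_normed_vector set \<Rightarrow> ('a \<Rightarrow> real) \<Rightarrow> ('a \<Rightarrow> 'a \<Rightarrow>\<^sub>L real) \<Rightarrow> real \<Rightarrow> bool" where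
  "strongly_convex_wrt C f D \<mu> \<longleftrightarrow>
     (\<forall>M\<in>C. \<forall>N\<in>C. f N - f M - blinfun_apply (D M) (N - M) \<ge> \<mu> / 2 * (norm (N - M))\<^sup>2)"


section \<open>Designs\<close>

definition designs :: "'x::metric_space set \<Rightarrow> 'x measure set" where
  "designs X = {\<xi>. sets \<xi> = sets (restrict_space borel X) \<and> prob_space \<xi>}"

definition design_support :: "'x::metric_space measure \<Rightarrow> 'x set" where
  "design_support \<xi> = {x \<in> space \<xi>. \<forall>U. open U \<and> x \<in> U \<longrightarrow> emeasure \<xi> (U \<inter> space \<xi>) > 0}"

definition designs_in :: "'x::metric_space set \<Rightarrow> 'x set \<Rightarrow> 'x measure set" where
  "designs_in X X' = {\<xi> \<in> designs X. design_support \<xi> \<subseteq> X'}"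

definition info_matrix :: "('x \<Rightarrow> real ^ 'd ^ 'd) \<Rightarrow> 'x measure \<Rightarrow> real ^ 'd ^ 'd" where
  "info_matrix m \<xi> = (\<integral>x. m x \<partial>\<xi>)"

definition fin_designs_in ::
  "('x::metric_space \<Rightarrow> real ^ 'd ^ 'd) \<Rightarrow> (real ^ 'd ^ 'd \<Rightarrow> ereal) \<Rightarrow> 'x set \<Rightarrow> 'x set \<Rightarrow> 'x measure set"
where
  "fin_designs_in m \<Psi> X X' = {\<xi> \<in> designs_in X X'. \<Psi> (info_matrix m \<xi>) < \<infinity>}"

definition sensitivity ::
  "(real ^ 'd ^ 'd \<Rightarrow> (real ^ 'd ^ 'd) \<Rightarrow>\<^sub>L real) \<Rightarrow> ('x \<Rightarrow> real ^ 'd ^ 'd) \<Rightarrow> real ^ 'd ^ 'd \<Rightarrow> 'x \<Rightarrow> real"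
where
  "sensitivity D m M x = blinfun_apply (D M) (m x - M)"


section \<open>The strict algorithms\<close>

text \<open>\<open>upd X' \<xi> x\<close> is the next discretization set, \<open>K\<close> the set of iteration indices, and \<open>Xs k\<close>,
  \<open>\<xi> k\<close>, \<open>x k\<close> are the discretization set, design and point of iteration \<open>k\<close>; their values at
  \<open>k \<notin> K\<close> are unconstrained. \<open>\<delta>1\<close> and \<open>\<delta>2\<close> are the tolerances of the first step (over designs)
  and of the second step (over points).\<close>

definition strict_algorithm ::
  "('x set \<Rightarrow> 'x measure \<Rightarrow> 'x \<Rightarrow> 'x set) \<Rightarrow> 'x::metric_space set \<Rightarrow> ('x \<Rightarrow> real ^ 'd ^ 'd) \<Rightarrow>
   (real ^ 'd ^ 'd \<Rightarrow> ereal) \<Rightarrow> (real ^ 'd ^ 'd \<Rightarrow> (real ^ 'd ^ 'd) \<Rightarrow>\<^sub>L real) \<Rightarrow> 'x set \<Rightarrow>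
   real \<Rightarrow> (nat \<Rightarrow> real) \<Rightarrow> (nat \<Rightarrow> real) \<Rightarrow>
   nat set \<Rightarrow> (nat \<Rightarrow> 'x set) \<Rightarrow> (nat \<Rightarrow> 'x measure) \<Rightarrow> (nat \<Rightarrow> 'x) \<Rightarrow> bool"
where
  "strict_algorithm upd X m \<Psi> D X0 \<epsilon> \<delta>1 \<delta>2 K Xs \<xi> x \<longleftrightarrow>
     (let continue_at = (\<lambda>k. sensitivity D m (info_matrix m (\<xi> k)) (x k) < - \<epsilon> + \<delta>2 k) in
        ((\<exists>k'. K = {0..k'} \<and> (\<forall>k<k'. continue_at k) \<and> \<not> continue_at k')
          \<or> (K = UNIV \<and> (\<forall>k. continue_at k))) \<and>
        Xs 0 = X0 \<and>
        (\<forall>k. Suc k \<in> K \<longrightarrow> Xs (Suc k) = upd (Xs k) (\<xi> k) (x k)) \<and>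
        (\<forall>k\<in>K. approx_solution (\<delta>1 k) (designs_in X (Xs k)) (\<lambda>\<eta>. \<Psi> (info_matrix m \<eta>)) (\<xi> k)) \<and>
        (\<forall>k\<in>K. approx_solution (\<delta>2 k) X
                  (\<lambda>y. ereal (sensitivity D m (info_matrix m (\<xi> k)) y)) (x k)))"

definition upd_without_exchange :: "'x set \<Rightarrow> 'x measure \<Rightarrow> 'x \<Rightarrow> 'x set" where
  "upd_without_exchange X' \<xi> x = X' \<union> {x}"

definition upd_with_exchange :: "'x::metric_space set \<Rightarrow> 'x measure \<Rightarrow> 'x \<Rightarrow> 'x set" where
  "upd_with_exchange X' \<xi> x = design_support \<xi> \<union> {x}"


section \<open>Constants\<close>

definition active_sets :: "'a::real_vector set \<Rightarrow> 'a \<Rightarrow> 'a set set" where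
  "active_sets A M =
     {S. S \<subseteq> A \<and> finite S \<and>
         (\<exists>w. (\<forall>n\<in>S. 0 < w n) \<and> (\<Sum>n\<in>S. w n) = (1::real) \<and> M = (\<Sum>n\<in>S. w n *\<^sub>R n))}"

definition toward_vertices :: "'a::real_normed_vector set \<Rightarrow> ('a \<Rightarrow> 'a \<Rightarrow>\<^sub>L real) \<Rightarrow> 'a \<Rightarrow> 'a set"
where
  "toward_vertices A D M = {a. is_arg_min (blinfun_apply (D M)) (\<lambda>a. a \<in> A) a}"

definition away_candidates :: "('a::real_normed_vector \<Rightarrow> 'a \<Rightarrow>\<^sub>L real) \<Rightarrow> 'a \<Rightarrow> 'a set \<Rightarrow> 'a set"
where
  "away_candidates D M S = {n. is_arg_max (blinfun_apply (D M)) (\<lambda>n. n \<in> S) n}"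

definition away_vertices :: "'a::real_normed_vector set \<Rightarrow> ('a \<Rightarrow> 'a \<Rightarrow>\<^sub>L real) \<Rightarrow> 'a \<Rightarrow> 'a set"
where
  "away_vertices A D M =
     {n. is_arg_min (blinfun_apply (D M)) (\<lambda>n. n \<in> (\<Union>S\<in>active_sets A M. away_candidates D M S)) n}"

text \<open>The choice of the two vertices is immaterial: \<open>D M\<close> is constant on each of the two sets,
  which are nonempty for finite nonempty \<open>A\<close> and \<open>M \<in> convex hull A\<close>.\<close>

definition step_ratio ::
  "'a::real_normed_vector set \<Rightarrow> ('a \<Rightarrow> 'a \<Rightarrow>\<^sub>L real) \<Rightarrow> 'a \<Rightarrow> 'a \<Rightarrow> real" where
  "step_ratio A D M M' =
     blinfun_apply (D M) (M' - M) /
     blinfun_apply (D M) ((SOME a. a \<in> toward_vertices A D M) - (SOME n. n \<in> away_vertices A D M))"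

definition geometric_strong_convexity ::
  "'a::real_normed_vector set \<Rightarrow> 'a set \<Rightarrow> ('a \<Rightarrow> real) \<Rightarrow> ('a \<Rightarrow> 'a \<Rightarrow>\<^sub>L real) \<Rightarrow> real" where
  "geometric_strong_convexity A C f D =
     Inf {2 / (step_ratio A D M M')\<^sup>2 * (f M' - f M - blinfun_apply (D M) (M' - M)) | M M'.
            M \<in> C \<and> M' \<in> C \<and> blinfun_apply (D M) (M' - M) < 0}"

definition curvature_const ::
  "'a::real_normed_vector set \<Rightarrow> ('a \<Rightarrow> real) \<Rightarrow> ('a \<Rightarrow> 'a \<Rightarrow>\<^sub>L real) \<Rightarrow> real" where
  "curvature_const C f D =
     Sup {2 / \<alpha>\<^sup>2 * (f (M + \<alpha> *\<^sub>R (M' - M)) - f M - \<alpha> * blinfun_apply (D M) (M' - M)) | M M' \<alpha>.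
            M \<in> C \<and> M' \<in> C \<and> \<alpha> \<in> {0<..1}}"

definition pwidth :: "'a::euclidean_space set \<Rightarrow> real" where
  "pwidth A =
     Min {setdist F (convex hull (A - F)) | F.
            F face_of (convex hull A) \<and> F \<noteq> {} \<and> F \<noteq> convex hull A}"

end

theory Submission
  imports Defs
begin

text \<open>
  Since \<open>A\<close> is finite, the information matrices of designs form the polytope \<open>P = convex hull A\<close>, and
  the strict algorithms can be compared with a single step of the Frank--Wolfe algorithm on \<open>P\<close>.
  Write \<open>M\<close> for the current information matrix, \<open>g\<close> for the derivative of the objective \<open>f\<close> at \<open>M\<close>
  and \<open>s\<close> for the vertex added to the discretization, which minimizes \<open>g\<close> over \<open>A\<close>. The next design
  is optimal on a discretization that contains the support of the current design and a preimage of \<open>s\<close>, so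
  its value is at most that of every point of the segment from \<open>M\<close> to \<open>s\<close>.

  Frank--Wolfe steps alone are not linearly convergent on a polytope. They are here because \<open>M\<close> is
  fully corrected: as \<open>M\<close> minimizes \<open>f\<close> over the hull of the current atoms and is a convex combination
  of them with positive weights, \<open>g\<close> is constant on an active set of \<open>M\<close>
  (\<open>first_order_optimality\<close>, \<open>constant_on_active_set\<close>). Hence the away vertex \<open>n\<^sub>M\<close> satisfies
  \<open>g n\<^sub>M = g M\<close>, and the denominator in the definition of geometric strong convexity is, up to sign, the
  Frank--Wolfe gap \<open>h = g (M - s)\<close>. Geometric strong convexity then gives
  \<open>f M - f\<^sup>* \<le> h\<^sup>2 / (2 \<mu>\<^sub>P)\<close> (\<open>gap_bound\<close>), while the curvature constant gives a decrease of at least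
  \<open>h\<^sup>2 / (2 C\<^sub>P)\<close> for step length \<open>h / C\<^sub>P \<le> 1\<close>, and of at least \<open>h / 2 \<ge> (f M - f\<^sup>*) / 2\<close> for a full step
  otherwise (\<open>frank_wolfe_step_contracts\<close>).

  For the explicit rate, smoothness gives \<open>C\<^sub>P \<le> L * (diameter P)\<^sup>2\<close>, and \<open>\<mu>\<^sub>P \<ge> \<mu> * (pwidth A)\<^sup>2\<close> reduces to the
  inequality \<open>pwidth A * g (M - M') \<le> norm (M - M') * g (n\<^sub>M - m\<^sub>M)\<close>, where \<open>m\<^sub>M\<close> minimizes \<open>g\<close> over \<open>A\<close>
  (\<open>pwidth_mult_decrease_le\<close>). To prove it, \<open>M - M'\<close> is stretched to the longest multiple of the form
  \<open>p - q\<close> with \<open>p\<close> in the hull of an active set of \<open>M\<close> and \<open>q \<in> P\<close>. Maximality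
  forces \<open>p\<close> to avoid the vertices of the face that has \<open>q\<close> in its relative interior, so \<open>norm (p - q)\<close> is
  at least the pyramidal width (\<open>longest_difference_avoids_face\<close>).
\<close>

section \<open>Faces and the pyramidal width\<close>

lemma linear_le_on_convex_hull:
  assumes "linear g" "\<forall>y\<in>S. g y \<le> (c::real)" "x \<in> convex hull S"
  shows "g x \<le> c"
proof -
  have "convex {x. g x \<le> c}"
    using convex_linear_vimage[OF assms(1) convex_real_interval(2)[of c]] by (simp add: vimage_def)
  then have "convex hull S \<subseteq> {x. g x \<le> c}"
    using assms(2) by (intro hull_minimal) auto
  then show ?thesis using assms(3) by auto
qed

lemma linear_ge_on_convex_hull:
  assumes "linear g" "\<forall>y\<in>S. (c::real) \<le> g y" "x \<in> convex hull S"
  shows "c \<le> g x"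
  using linear_le_on_convex_hull[of "\<lambda>x. - g x" S "- c" x] assms
  by (simp add: linear_compose_neg)

text \<open>The complement of a face in a convex set is convex, and here it contains \<open>A - F\<close>.\<close>
lemma face_disjoint_hull_of_rest:
  assumes F: "F face_of (convex hull A)"
  shows "F \<inter> convex hull (A - F) = {}"
proof -
  have "x \<in> convex hull A - F"
    if ab: "a \<in> convex hull A - F" "b \<in> convex hull A - F" "x \<in> open_segment a b" for a b x
  proof -
    have "x \<notin> F" using F ab unfolding face_of_def by blast
    moreover have "x \<in> convex hull A"
      using ab by (meson DiffD1 closed_segment_subset convex_convex_hull segment_open_subset_closed subsetD)
    ultimately show ?thesis by simp
  qed
  then have "convex (convex hull A - F)" unfolding convex_contains_open_segment by blast
  then have "convex hull (A - F) \<subseteq> convex hull A - F"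
    by (intro hull_minimal) (auto simp: hull_inc)
  then show ?thesis by blast
qed

text \<open>A minimal face containing the point works: the relative boundary of a polytope is the union of
  its facets, so a point of that boundary would lie in a smaller face.\<close>
lemma face_containing_in_rel_interior:
  fixes P :: "'a::euclidean_space set"
  assumes P: "polytope P" and q: "q \<in> P"
  obtains F where "F face_of P" "q \<in> rel_interior F"
proof -
  let ?\<F> = "{F. F face_of P \<and> q \<in> F}"
  have "finite ?\<F>" using finite_polytope_faces[OF P] by (rule rev_finite_subset) auto
  moreover have "P \<in> ?\<F>" using q P by (simp add: face_of_refl polytope_imp_convex)
  ultimately obtain F where F: "F \<in> ?\<F>" and min: "\<And>G. G \<in> ?\<F> \<Longrightarrow> G \<subseteq> F \<Longrightarrow> F = G"
    using finite_has_minimal[of ?\<F>] by blast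
  have "q \<in> rel_interior F"
  proof (rule ccontr)
    assume "q \<notin> rel_interior F"
    moreover have "polyhedron F"
      using F P by (auto intro: face_of_polyhedron_polyhedron polytope_imp_polyhedron)
    ultimately obtain G where G: "G facet_of F" "q \<in> G"
      using rel_boundary_of_polyhedron[of F] F by blast
    then have "G \<in> ?\<F>" "G \<subseteq> F"
      using F face_of_trans facet_of_imp_face_of facet_of_imp_subset by blast+
    then show False using min G facet_of_irrefl by metis
  qed
  with F that show ?thesis by blast
qed

lemma finite_face_distances:
  fixes A :: "'a::euclidean_space set"
  assumes "finite A"
  shows "finite {setdist F (convex hull (A - F)) | F.
            F face_of (convex hull A) \<and> F \<noteq> {} \<and> F \<noteq> convex hull A}"
proof -
  have "finite {F. F face_of (convex hull A) \<and> F \<noteq> {} \<and> F \<noteq> convex hull A}"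
    using finite_polytope_faces[of "convex hull A"] assms polytope_def
    by (blast intro: rev_finite_subset)
  then show ?thesis by (rule finite_image_set)
qed

lemma pwidth_le_setdist:
  fixes A :: "'a::euclidean_space set"
  assumes "finite A" "F face_of (convex hull A)" "F \<noteq> {}" "F \<noteq> convex hull A"
  shows "pwidth A \<le> setdist F (convex hull (A - F))"
  unfolding pwidth_def using assms by (intro Min_le[OF finite_face_distances]) auto

text \<open>Each face has positive distance from the compact, disjoint hull of the other points of \<open>A\<close>;
  an extreme point shows that the minimum is taken over a nonempty set of faces.\<close>
lemma pwidth_pos:
  fixes A :: "'a::euclidean_space set"
  assumes A: "finite A" and card: "2 \<le> card A"
  shows "0 < pwidth A"
proof -
  let ?P = "convex hull A"
  have P: "polytope ?P" using A polytope_def by blast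
  have pos: "0 < setdist F (convex hull (A - F))"
    if F: "F face_of ?P" "F \<noteq> {}" "F \<noteq> ?P" for F
  proof -
    have "A - F \<noteq> {}"
    proof
      assume "A - F = {}"
      then have "?P \<subseteq> F" using F(1) by (intro hull_minimal) (auto simp: face_of_imp_convex)
      with F(1,3) show False using face_of_imp_subset by blast
    qed
    moreover have "compact F" 
      using F(1) P by (blast intro: face_of_imp_compact polytope_imp_compact polytope_imp_convex)
    moreover have "closed (convex hull (A - F))"
      using A by (simp add: compact_imp_closed finite_imp_compact_convex_hull)
    ultimately show ?thesis
      using F(2) face_disjoint_hull_of_rest[OF F(1)]
      by (simp add: setdist_gt_0_compact_closed)
  qed
  obtain v where v: "v extreme_point_of ?P"
    using extreme_point_exists_convex[of ?P] P card
    by (metis card.empty convex_hull_eq_empty not_numeral_le_zero polytope_imp_compact polytope_imp_convex)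
  then have "{v} face_of ?P" by (simp add: face_of_singleton)
  moreover have "{v} \<noteq> ?P"
  proof
    assume "{v} = ?P"
    then have "A \<subseteq> {v}" by (metis hull_subset)
    then have "card A \<le> card {v}" by (intro card_mono) auto
    with card show False by simp
  qed
  ultimately show ?thesis
    unfolding pwidth_def using pos
    by (subst Min_gr_iff[OF finite_face_distances[OF A]]) auto
qed

text \<open>Among all multiples of \<open>M - M'\<close> in the compact set \<open>convex hull S - convex hull A\<close>, take the
  longest one, \<open>p - q\<close>, and let \<open>F\<close> be the face with \<open>q\<close> in its relative interior. If \<open>p\<close> put
  weight on some \<open>n \<in> F\<close>, then moving both \<open>p\<close> and \<open>q\<close> a little away from \<open>n\<close> would stay in the two hulls and
  lengthen the difference.\<close>
lemma longest_difference_avoids_face: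
  fixes A :: "'a::euclidean_space set"
  assumes A: "finite A" and S: "S \<subseteq> A"
    and M: "M \<in> convex hull S" and M': "M' \<in> convex hull A" and ne: "M \<noteq> M'"
  obtains \<rho> p q F where "0 < \<rho>" "p \<in> convex hull S" "q \<in> convex hull A" "\<rho> *\<^sub>R (M - M') = p - q"
    "F face_of (convex hull A)" "q \<in> F" "p \<in> convex hull (A - F)"
proof -
  have fS: "finite S" using A S finite_subset by blast
  define C where "C = {p - q | p q. p \<in> convex hull S \<and> q \<in> convex hull A}"
  define \<Lambda> where "\<Lambda> = (\<lambda>t. t *\<^sub>R (M - M')) -` C"
  have compC: "compact C"
    unfolding C_def using fS A by (intro compact_differences finite_imp_compact_convex_hull)
  have "closed \<Lambda>"
    unfolding \<Lambda>_def using compC by (intro closed_vimage compact_imp_closed continuous_intros)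
  moreover have "bounded \<Lambda>"
  proof -
    obtain B where B: "\<And>c. c \<in> C \<Longrightarrow> norm c \<le> B"
      using compact_imp_bounded[OF compC] bounded_iff by metis
    have "norm t \<le> B / norm (M - M')" if "t \<in> \<Lambda>" for t
      using B[of "t *\<^sub>R (M - M')"] that ne by (simp add: \<Lambda>_def pos_le_divide_eq)
    then show ?thesis by (auto simp: bounded_iff)
  qed
  ultimately have "compact \<Lambda>" by (simp add: compact_eq_bounded_closed)
  moreover have one: "1 \<in> \<Lambda>" using M M' by (auto simp: \<Lambda>_def C_def)
  ultimately obtain \<rho> where \<rho>: "\<rho> \<in> \<Lambda>" "\<And>t. t \<in> \<Lambda> \<Longrightarrow> t \<le> \<rho>"
    using compact_attains_sup[of \<Lambda>] by auto
  obtain p q where pq: "p \<in> convex hull S" "q \<in> convex hull A" "\<rho> *\<^sub>R (M - M') = p - q"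
    using \<rho>(1) by (auto simp: \<Lambda>_def C_def)
  have pos: "0 < \<rho>" using \<rho>(2)[OF one] by simp
  obtain F where F: "F face_of (convex hull A)" and qF: "q \<in> rel_interior F"
    using face_containing_in_rel_interior[of "convex hull A" q] A pq(2) polytope_def by blast
  obtain w where w: "\<And>y. y \<in> S \<Longrightarrow> 0 \<le> w y" "sum w S = 1" "(\<Sum>y\<in>S. w y *\<^sub>R y) = p"
    using pq(1) convex_hull_finite[OF fS] by auto
  have zero: "w n = 0" if n: "n \<in> S" "n \<in> F" for n
  proof (rule ccontr)
    assume "w n \<noteq> 0"
    then have wn: "0 < w n" using w(1) n by force
    have "n \<in> affine hull F" using n by (simp add: hull_inc)
    then obtain c where c: "1 < c" "\<And>e. 1 < e \<Longrightarrow> e \<le> c \<Longrightarrow> (1 - e) *\<^sub>R n + e *\<^sub>R q \<in> F"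
      using convex_rel_interior_if[OF face_of_imp_convex[OF F] qF] by blast
    \<comment> \<open>The points \<open>p\<close> and \<open>q\<close> are expanded from \<open>n\<close> by the factor \<open>e > 1\<close>; \<open>e \<le> c\<close> keeps the image
      of \<open>q\<close> in \<open>F\<close>, and \<open>e \<le> 1 + w n\<close> keeps the weight of \<open>n\<close> in the image of \<open>p\<close> nonnegative.\<close>
    define e where "e = min c (1 + w n)"
    have e: "1 < e" "e \<le> c" "e - 1 \<le> w n" using c wn by (auto simp: e_def)
    have "(1 - e) *\<^sub>R n + e *\<^sub>R q \<in> convex hull A"
      using c(2)[OF e(1,2)] F face_of_imp_subset by blast
    moreover have "(1 - e) *\<^sub>R n + e *\<^sub>R p \<in> convex hull S"
    proof -
      define u where "u y = e * w y + (if y = n then 1 - e else 0)" for y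
      have "w n \<le> e * w n" using e wn by simp
      then have "0 \<le> e * w n + (1 - e)" using e(3) by linarith
      then have "\<forall>y\<in>S. 0 \<le> u y" using w(1) e by (auto simp: u_def)
      moreover have "sum u S = 1"
        using w(2) n fS by (simp add: u_def sum.distrib sum.delta flip: sum_distrib_left)
      moreover have "(\<Sum>y\<in>S. u y *\<^sub>R y) = (1 - e) *\<^sub>R n + e *\<^sub>R p"
      proof -
        have "(\<Sum>y\<in>S. u y *\<^sub>R y) = (\<Sum>y\<in>S. e *\<^sub>R (w y *\<^sub>R y) + (if y = n then (1 - e) *\<^sub>R n else 0))"
          by (rule sum.cong) (auto simp: u_def algebra_simps)
        also have "\<dots> = e *\<^sub>R p + (1 - e) *\<^sub>R n"
          using n fS by (simp add: sum.distrib sum.delta scaleR_right.sum flip: w(3))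
        finally show ?thesis by simp
      qed
      ultimately show ?thesis unfolding convex_hull_finite[OF fS] by blast
    qed
    moreover have "(e * \<rho>) *\<^sub>R (M - M')
        = ((1 - e) *\<^sub>R n + e *\<^sub>R p) - ((1 - e) *\<^sub>R n + e *\<^sub>R q)"
    proof -
      have "(e * \<rho>) *\<^sub>R (M - M') = e *\<^sub>R (p - q)" using pq(3) by (metis scaleR_scaleR)
      then show ?thesis by (simp add: algebra_simps)
    qed
    ultimately have "e * \<rho> \<in> \<Lambda>" unfolding \<Lambda>_def C_def vimage_def by blast
    then show False using \<rho>(2) e(1) pos by fastforce
  qed
  have "p \<in> convex hull (S - F)"
  proof -
    have "sum w (S - F) = 1" "(\<Sum>y\<in>S - F. w y *\<^sub>R y) = p"
      using w(2,3) zero fS by (auto intro!: trans[OF sum.mono_neutral_left[of S "S - F"]])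
    then show ?thesis using w(1) convex_hull_finite[of "S - F"] fS by auto
  qed
  then have "p \<in> convex hull (A - F)" using hull_mono[of "S - F" "A - F"] S by blast
  with that[OF pos pq F] qF rel_interior_subset show ?thesis by blast
qed

text \<open>A linear function cannot decrease along \<open>M - M'\<close> faster, per unit length, than its total
  variation over the vertices divided by the pyramidal width: rescaling \<open>M - M'\<close> to the difference \<open>p - q\<close>
  above leaves the decrease per unit length unchanged, \<open>g (p - q)\<close> is at most that variation, and
  \<open>norm (p - q)\<close> is at least the distance of a face from the hull of the other points.\<close>
lemma pwidth_mult_decrease_le:
  fixes A :: "'a::euclidean_space set"
  assumes A: "finite A" and S: "S \<subseteq> A"
    and M: "M \<in> convex hull S" and M': "M' \<in> convex hull A"
    and g: "linear (g :: 'a \<Rightarrow> real)" and decr: "g M' \<le> g M"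
    and n: "\<forall>y\<in>S. g y \<le> g n" and a: "\<forall>y\<in>A. g a \<le> g y"
  shows "pwidth A * (g M - g M') \<le> norm (M - M') * (g n - g a)"
proof (cases "M = M'")
  case False
  obtain \<rho> p q F where \<rho>: "0 < \<rho>" "p \<in> convex hull S" "q \<in> convex hull A" "\<rho> *\<^sub>R (M - M') = p - q"
    and F: "F face_of (convex hull A)" "q \<in> F" "p \<in> convex hull (A - F)"
    using longest_difference_avoids_face[OF A S M M' False] .
  have "F \<noteq> convex hull A"
    using F(3) face_disjoint_hull_of_rest[OF F(1)] hull_mono[of "A - F" A] by blast
  then have "pwidth A \<le> setdist F (convex hull (A - F))"
    using pwidth_le_setdist[OF A F(1)] F(2) by blast
  also have "\<dots> \<le> dist q p" using F(2,3) by (rule setdist_le_dist)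
  also have "\<dots> = \<rho> * norm (M - M')"
    using \<rho>(1) by (simp add: dist_norm norm_minus_commute flip: \<rho>(4))
  finally have pw: "pwidth A \<le> \<rho> * norm (M - M')" .
  have gpq: "\<rho> * (g M - g M') = g p - g q"
    using arg_cong[OF \<rho>(4), of g] g by (simp add: linear_diff linear_scale)
  have pa: "g a \<le> g p" "g q \<ge> g a" "g p \<le> g n"
    using linear_le_on_convex_hull[OF g n \<rho>(2)] linear_ge_on_convex_hull[OF g a \<rho>(3)]
      linear_ge_on_convex_hull[OF g _ \<rho>(2), of "g a"] a S by auto
  have le: "\<rho> * (g M - g M') \<le> g n - g a" using gpq pa by linarith
  have "pwidth A * (g M - g M') \<le> (\<rho> * norm (M - M')) * (g M - g M')"
    using pw decr by (intro mult_right_mono) auto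
  also have "\<dots> = norm (M - M') * (\<rho> * (g M - g M'))" by simp
  also have "\<dots> \<le> norm (M - M') * (g n - g a)" using le by (rule mult_left_mono) simp
  finally show ?thesis .
qed simp

section \<open>Away vertices, geometric strong convexity and curvature\<close>

lemma active_setsD:
  assumes "S \<in> active_sets A M"
  shows "S \<subseteq> A" "finite S" "S \<noteq> {}" "M \<in> convex hull S"
proof -
  show "S \<subseteq> A" "finite S" "S \<noteq> {}" using assms by (auto simp: active_sets_def)
  then show "M \<in> convex hull S"
    using assms convex_hull_finite[of S] by (force simp: active_sets_def)
qed

lemma active_sets_in_hull: "S \<in> active_sets A M \<Longrightarrow> M \<in> convex hull A"
  using active_setsD(1,4) by (metis hull_mono subsetD)

lemma active_set_exists:
  assumes A: "finite A" and M: "M \<in> convex hull A"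
  obtains S where "S \<in> active_sets A M"
proof -
  obtain w where w: "\<And>y. y \<in> A \<Longrightarrow> 0 \<le> w y" "sum w A = 1" "(\<Sum>y\<in>A. w y *\<^sub>R y) = M"
    using M convex_hull_finite[OF A] by auto
  define S where "S = {y \<in> A. w y \<noteq> 0}"
  have "sum w S = 1" "(\<Sum>y\<in>S. w y *\<^sub>R y) = M"
    using w(2,3) A by (auto simp: S_def intro!: trans[OF sum.mono_neutral_left[of A]])
  then have "S \<in> active_sets A M"
    using w(1) A by (force simp: active_sets_def S_def order_le_less)
  with that show ?thesis .
qed

lemma active_sets_mono: "A \<subseteq> B \<Longrightarrow> active_sets A M \<subseteq> active_sets B M"
  unfolding active_sets_def by blast

text \<open>This opens up the two choices inside \<open>step_ratio\<close>. The away vertex \<open>n\<close> is the largest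
  element, in terms of \<open>D M\<close>, of some active set, and no active set has a smaller maximum.\<close>
lemma step_ratio_vertices:
  assumes A: "finite A" "M \<in> convex hull A"
  obtains a n S where "a \<in> A" "\<forall>y\<in>A. blinfun_apply (D M) a \<le> blinfun_apply (D M) y"
    "S \<in> active_sets A M" "n \<in> S" "\<forall>y\<in>S. blinfun_apply (D M) y \<le> blinfun_apply (D M) n"
    "\<And>T. T \<in> active_sets A M \<Longrightarrow> \<exists>y\<in>T. blinfun_apply (D M) n \<le> blinfun_apply (D M) y"
    "\<And>M'. step_ratio A D M M' = blinfun_apply (D M) (M' - M) / blinfun_apply (D M) (a - n)"
proof -
  define g where "g = blinfun_apply (D M)"
  have "A \<noteq> {}" using A by auto
  then have "\<exists>a. a \<in> toward_vertices A D M"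
    unfolding toward_vertices_def using ex_is_arg_min_if_finite[OF A(1), of "blinfun_apply (D M)"] by blast
  define a where "a = (SOME a. a \<in> toward_vertices A D M)"
  have a: "a \<in> toward_vertices A D M" unfolding a_def using \<open>\<exists>a. _\<close> by (rule someI_ex)
  have cand: "\<exists>n. n \<in> away_candidates D M T" if "T \<in> active_sets A M" for T
  proof -
    have T: "finite T" "T \<noteq> {}" using active_setsD[OF that] by auto
    then have "Max (g ` T) \<in> g ` T" by simp
    then obtain n where "n \<in> T" "g n = Max (g ` T)" by auto
    then have "n \<in> away_candidates D M T"
      using T by (auto simp: away_candidates_def is_arg_max_def g_def not_less)
    then show ?thesis ..
  qed
  define V where "V = (\<Union>S\<in>active_sets A M. away_candidates D M S)"
  have "V \<subseteq> A"
    using active_setsD(1) by (fastforce simp: V_def away_candidates_def is_arg_max_def)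
  then have "finite V" using A finite_subset by blast
  moreover obtain T where "T \<in> active_sets A M" using active_set_exists[OF A] .
  with cand have "V \<noteq> {}" unfolding V_def by blast
  ultimately have "\<exists>n. n \<in> away_vertices A D M"
    unfolding away_vertices_def V_def[symmetric]
    using ex_is_arg_min_if_finite[of V "blinfun_apply (D M)"] by blast
  define n where "n = (SOME n. n \<in> away_vertices A D M)"
  have n: "n \<in> away_vertices A D M" unfolding n_def using \<open>\<exists>n. n \<in> away_vertices _ _ _\<close> by (rule someI_ex)
  then have "n \<in> V" and min: "\<And>y. y \<in> V \<Longrightarrow> g n \<le> g y"
    unfolding away_vertices_def V_def[symmetric] by (auto simp: is_arg_min_def g_def not_less)
  then obtain S where S: "S \<in> active_sets A M" "n \<in> away_candidates D M S" by (auto simp: V_def)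
  show ?thesis
  proof
    show "a \<in> A" "\<forall>y\<in>A. blinfun_apply (D M) a \<le> blinfun_apply (D M) y"
      using a by (auto simp: toward_vertices_def is_arg_min_def not_less)
    show "S \<in> active_sets A M" by fact
    show "n \<in> S" "\<forall>y\<in>S. blinfun_apply (D M) y \<le> blinfun_apply (D M) n"
      using S(2) by (auto simp: away_candidates_def is_arg_max_def not_less)
    show "\<exists>y\<in>T. blinfun_apply (D M) n \<le> blinfun_apply (D M) y" if T: "T \<in> active_sets A M" for T
    proof -
      obtain y where "y \<in> away_candidates D M T" using cand[OF T] by blast
      then have "y \<in> V" "y \<in> T" using T by (auto simp: V_def away_candidates_def is_arg_max_def)
      with min show ?thesis by (auto simp: g_def)
    qed
    show "step_ratio A D M M' = blinfun_apply (D M) (M' - M) / blinfun_apply (D M) (a - n)" for M'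
      by (simp add: step_ratio_def a_def n_def)
  qed
qed

locale smooth_convex_polytope =
  fixes A :: "'a::euclidean_space set" and f :: "'a \<Rightarrow> real" and D :: "'a \<Rightarrow> 'a \<Rightarrow>\<^sub>L real"
    and \<mu> L :: real
  assumes finite_A: "finite A" and card_A: "2 \<le> card A"
    and \<mu>_pos: "0 < \<mu>" and strongly_convex: "strongly_convex_wrt (convex hull A) f D \<mu>"
    and L_pos: "0 < L" and smooth: "smooth_wrt (convex hull A) f D L"
begin

abbreviation "P \<equiv> convex hull A"
abbreviation "\<mu>\<^sub>P \<equiv> geometric_strong_convexity A P f D"
abbreviation "C\<^sub>P \<equiv> curvature_const P f D"
abbreviation "bregman M M' \<equiv> f M' - f M - blinfun_apply (D M) (M' - M)"

lemma bregman_lower: "M \<in> P \<Longrightarrow> M' \<in> P \<Longrightarrow> \<mu> / 2 * (norm (M' - M))\<^sup>2 \<le> bregman M M'"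
  using strongly_convex by (auto simp: strongly_convex_wrt_def)

lemma bregman_upper: "M \<in> P \<Longrightarrow> M' \<in> P \<Longrightarrow> bregman M M' \<le> L / 2 * (norm (M' - M))\<^sup>2"
  using smooth by (auto simp: smooth_wrt_def)

lemma tangent_below: "M \<in> P \<Longrightarrow> M' \<in> P \<Longrightarrow> f M + blinfun_apply (D M) (M' - M) \<le> f M'"
  using bregman_lower[of M M'] \<mu>_pos zero_le_power2[of "norm (M' - M)"]
  by (smt (verit) divide_nonneg_pos mult_nonneg_nonneg)

lemma segment_in_P: "M \<in> P \<Longrightarrow> M' \<in> P \<Longrightarrow> 0 \<le> t \<Longrightarrow> t \<le> 1 \<Longrightarrow> M + t *\<^sub>R (M' - M) \<in> P"
  using convexD_alt[OF convex_convex_hull, of M A M' t] by (simp add: algebra_simps)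

lemma two_points:
  obtains M M' where "M \<in> A" "M' \<in> A" "M \<noteq> M'"
  using card_A by (metis card_2_iff' obtain_subset_with_card_n subset_iff)

lemma linear_D: "linear (blinfun_apply (D M))"
  by (intro bounded_linear.linear blinfun.bounded_linear_right)

lemma diameter_pos: "0 < diameter P"
proof -
  obtain M M' where "M \<in> A" "M' \<in> A" "M \<noteq> M'" by (rule two_points)
  then have "0 < dist M M'" "M \<in> P" "M' \<in> P" by (auto simp: hull_inc)
  moreover have "bounded P" using finite_A by (simp add: finite_imp_bounded_convex_hull)
  ultimately show ?thesis using diameter_bounded_bound[of P M M'] by linarith
qed

subsection \<open>Curvature\<close>

lemma curvature_quotient_le:
  assumes "M \<in> P" "M' \<in> P" "\<alpha> \<in> {0<..1}"
  shows "2 / \<alpha>\<^sup>2 * (f (M + \<alpha> *\<^sub>R (M' - M)) - f M - \<alpha> * blinfun_apply (D M) (M' - M))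
    \<le> L * (diameter P)\<^sup>2"
proof -
  have \<alpha>: "0 < \<alpha>" "\<alpha> \<le> 1" using assms by auto
  have "f (M + \<alpha> *\<^sub>R (M' - M)) - f M - \<alpha> * blinfun_apply (D M) (M' - M)
      \<le> L / 2 * (\<alpha> * norm (M' - M))\<^sup>2"
    using bregman_upper[OF assms(1) segment_in_P[OF assms(1,2), of \<alpha>]] \<alpha>
    by (simp add: blinfun.scaleR_right)
  then have "2 / \<alpha>\<^sup>2 * (f (M + \<alpha> *\<^sub>R (M' - M)) - f M - \<alpha> * blinfun_apply (D M) (M' - M))
      \<le> 2 / \<alpha>\<^sup>2 * (L / 2 * (\<alpha> * norm (M' - M))\<^sup>2)"
    by (rule mult_left_mono) simp
  also have "\<dots> = L * (dist M' M)\<^sup>2" using \<alpha> by (simp add: power_mult_distrib dist_norm)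
  also have "\<dots> \<le> L * (diameter P)\<^sup>2"
    using L_pos assms finite_A
    by (intro mult_left_mono power_mono diameter_bounded_bound) (auto simp: finite_imp_bounded_convex_hull)
  finally show ?thesis .
qed

lemma bdd_above_curvature_quotients:
  "bdd_above {2 / \<alpha>\<^sup>2 * (f (M + \<alpha> *\<^sub>R (M' - M)) - f M - \<alpha> * blinfun_apply (D M) (M' - M)) | M M' \<alpha>.
            M \<in> P \<and> M' \<in> P \<and> \<alpha> \<in> {0<..1}}"
  using curvature_quotient_le by (intro bdd_aboveI[of _ "L * (diameter P)\<^sup>2"]) blast

lemma curvature_bound:
  assumes "M \<in> P" "M' \<in> P" "0 < \<alpha>" "\<alpha> \<le> 1"
  shows "f (M + \<alpha> *\<^sub>R (M' - M)) \<le> f M + \<alpha> * blinfun_apply (D M) (M' - M) + \<alpha>\<^sup>2 / 2 * C\<^sub>P"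
proof -
  have "2 / \<alpha>\<^sup>2 * (f (M + \<alpha> *\<^sub>R (M' - M)) - f M - \<alpha> * blinfun_apply (D M) (M' - M)) \<le> C\<^sub>P"
    unfolding curvature_const_def
    using assms by (intro cSup_upper[OF _ bdd_above_curvature_quotients]) auto
  then have "f (M + \<alpha> *\<^sub>R (M' - M)) - f M - \<alpha> * blinfun_apply (D M) (M' - M) \<le> C\<^sub>P / (2 / \<alpha>\<^sup>2)"
    using assms by (subst pos_le_divide_eq) (auto simp: mult.commute)
  then show ?thesis by (simp add: mult.commute)
qed

lemma curvature_le: "C\<^sub>P \<le> L * (diameter P)\<^sup>2"
proof -
  obtain M M' where "M \<in> A" "M' \<in> A" by (rule two_points)
  then have "M \<in> P" "M' \<in> P" "1 \<in> {0<..1::real}" by (auto simp: hull_inc)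
  then show ?thesis
    unfolding curvature_const_def
    by (intro cSup_least) (use curvature_quotient_le in blast)+
qed

lemma curvature_pos: "0 < C\<^sub>P"
proof -
  obtain M M' where M: "M \<in> A" "M' \<in> A" "M \<noteq> M'" by (rule two_points)
  then have P: "M \<in> P" "M' \<in> P" by (auto simp: hull_inc)
  have "0 < \<mu> / 2 * (norm (M' - M))\<^sup>2" using \<mu>_pos M by simp
  with bregman_lower[OF P] curvature_bound[OF P, of 1] show ?thesis by simp
qed

subsection \<open>Geometric strong convexity\<close>

text \<open>The second estimate carries the comparison with the pyramidal width: it turns strong convexity, which
  measures \<open>norm (M' - M)\<close>, into a bound in terms of \<open>step_ratio\<close>.\<close>
lemma step_ratio_pos:
  assumes "M \<in> P" "M' \<in> P" "blinfun_apply (D M) (M' - M) < 0"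
  shows "0 < step_ratio A D M M'" "pwidth A * step_ratio A D M M' \<le> norm (M' - M)"
proof -
  let ?g = "blinfun_apply (D M)"
  obtain a n S where a: "a \<in> A" "\<forall>y\<in>A. ?g a \<le> ?g y"
    and S: "S \<in> active_sets A M" "n \<in> S" "\<forall>y\<in>S. ?g y \<le> ?g n"
    and ratio: "\<And>M'. step_ratio A D M M' = ?g (M' - M) / ?g (a - n)"
    using step_ratio_vertices[OF finite_A assms(1), of D] by metis
  note S' = active_setsD[OF S(1)]
  have "?g a \<le> ?g M'" using linear_ge_on_convex_hull[OF linear_D a(2) assms(2)] .
  moreover have "?g M \<le> ?g n" using linear_le_on_convex_hull[OF linear_D S(3) S'(4)] .
  moreover have lt: "?g M' < ?g M" using assms(3) by (simp add: blinfun.diff_right)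
  ultimately have neg: "?g (a - n) < 0" by (simp add: blinfun.diff_right)
  then show "0 < step_ratio A D M M'" using assms(3) by (simp add: ratio divide_neg_neg)
  have "pwidth A * (?g M - ?g M') \<le> norm (M - M') * (?g n - ?g a)"
    using pwidth_mult_decrease_le[OF finite_A S'(1,4) assms(2) linear_D _ S(3) a(2)] lt by simp
  then have "pwidth A * (?g M - ?g M') / (?g n - ?g a) \<le> norm (M - M')"
    using neg by (subst pos_divide_le_eq) (auto simp: blinfun.diff_right)
  moreover have "step_ratio A D M M' = (?g M - ?g M') / (?g n - ?g a)"
    unfolding ratio blinfun.diff_right by (metis minus_diff_eq minus_divide_divide)
  ultimately show "pwidth A * step_ratio A D M M' \<le> norm (M' - M)"
    by (simp add: norm_minus_commute)
qed

lemma bdd_below_geometric_quotients: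
  "bdd_below {2 / (step_ratio A D M M')\<^sup>2 * bregman M M' | M M'.
            M \<in> P \<and> M' \<in> P \<and> blinfun_apply (D M) (M' - M) < 0}"
proof (rule bdd_belowI[of _ 0])
  fix y assume "y \<in> {2 / (step_ratio A D M M')\<^sup>2 * bregman M M' | M M'.
            M \<in> P \<and> M' \<in> P \<and> blinfun_apply (D M) (M' - M) < 0}"
  then obtain M M' where "y = 2 / (step_ratio A D M M')\<^sup>2 * bregman M M'" "M \<in> P" "M' \<in> P"
    by blast
  with tangent_below[of M M'] show "0 \<le> y" by simp
qed

lemma geometric_bound:
  assumes "M \<in> P" "M' \<in> P" "blinfun_apply (D M) (M' - M) < 0"
  shows "(step_ratio A D M M')\<^sup>2 / 2 * \<mu>\<^sub>P \<le> bregman M M'"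
proof -
  have "\<mu>\<^sub>P \<le> 2 / (step_ratio A D M M')\<^sup>2 * bregman M M'"
    unfolding geometric_strong_convexity_def
    using assms by (intro cInf_lower[OF _ bdd_below_geometric_quotients]) auto
  then have "(step_ratio A D M M')\<^sup>2 / 2 * \<mu>\<^sub>P
      \<le> (step_ratio A D M M')\<^sup>2 / 2 * (2 / (step_ratio A D M M')\<^sup>2 * bregman M M')"
    by (rule mult_left_mono) simp
  also have "\<dots> = bregman M M'" using step_ratio_pos(1)[OF assms] by simp
  finally show ?thesis .
qed

text \<open>This keeps the infimum defining \<open>\<mu>\<^sub>P\<close> from ranging over the empty set. Adding the strong
  convexity inequalities for \<open>(M, M')\<close> and \<open>(M', M)\<close> shows that one of the two directions is a descent
  direction.\<close>
lemma descent_pair_exists: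
  obtains M M' where "M \<in> P" "M' \<in> P" "blinfun_apply (D M) (M' - M) < 0"
proof -
  obtain M M' where M: "M \<in> A" "M' \<in> A" "M \<noteq> M'" by (rule two_points)
  then have P: "M \<in> P" "M' \<in> P" by (auto simp: hull_inc)
  have pos: "0 < \<mu> / 2 * (norm (M' - M))\<^sup>2" using \<mu>_pos M by simp
  then have "blinfun_apply (D M) (M' - M) < 0 \<or> blinfun_apply (D M') (M - M') < 0"
    using bregman_lower[OF P] bregman_lower[OF P(2,1)] by (simp only: norm_minus_commute[of M]) linarith
  with that P show ?thesis by blast
qed

lemma geometric_ge: "\<mu> * (pwidth A)\<^sup>2 \<le> \<mu>\<^sub>P"
  unfolding geometric_strong_convexity_def
proof (rule cInf_greatest)
  show "{2 / (step_ratio A D M M')\<^sup>2 * bregman M M' | M M'.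
            M \<in> P \<and> M' \<in> P \<and> blinfun_apply (D M) (M' - M) < 0} \<noteq> {}"
  proof -
    obtain M M' where "M \<in> P" "M' \<in> P" "blinfun_apply (D M) (M' - M) < 0"
      by (rule descent_pair_exists)
    then show ?thesis by blast
  qed
next
  fix y assume "y \<in> {2 / (step_ratio A D M M')\<^sup>2 * bregman M M' | M M'.
            M \<in> P \<and> M' \<in> P \<and> blinfun_apply (D M) (M' - M) < 0}"
  then obtain M M' where y: "y = 2 / (step_ratio A D M M')\<^sup>2 * bregman M M'"
    and M: "M \<in> P" "M' \<in> P" "blinfun_apply (D M) (M' - M) < 0" by blast
  let ?\<rho> = "step_ratio A D M M'"
  have \<rho>: "0 < ?\<rho>" "pwidth A * ?\<rho> \<le> norm (M' - M)" using step_ratio_pos[OF M] by auto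
  have "0 \<le> pwidth A" using pwidth_pos[OF finite_A card_A] by simp
  then have "(pwidth A * ?\<rho>)\<^sup>2 \<le> (norm (M' - M))\<^sup>2" using \<rho> by (intro power_mono) auto
  then have "\<mu> / 2 * (pwidth A * ?\<rho>)\<^sup>2 \<le> \<mu> / 2 * (norm (M' - M))\<^sup>2"
    using \<mu>_pos by (intro mult_left_mono) auto
  also have "\<dots> \<le> bregman M M'" using bregman_lower[OF M(1,2)] .
  finally have "2 / ?\<rho>\<^sup>2 * (\<mu> / 2 * (pwidth A * ?\<rho>)\<^sup>2) \<le> y"
    unfolding y by (rule mult_left_mono) simp
  moreover have "2 / ?\<rho>\<^sup>2 * (\<mu> / 2 * (pwidth A * ?\<rho>)\<^sup>2) = \<mu> * (pwidth A)\<^sup>2"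
    using \<rho>(1) by (simp add: power_mult_distrib)
  ultimately show "\<mu> * (pwidth A)\<^sup>2 \<le> y" by simp
qed

lemma geometric_pos: "0 < \<mu>\<^sub>P"
proof -
  have "0 < \<mu> * (pwidth A)\<^sup>2" using \<mu>_pos pwidth_pos[OF finite_A card_A] by simp
  with geometric_ge show ?thesis by simp
qed

lemma ratio_ge: "\<mu> / L * (pwidth A / diameter P)\<^sup>2 \<le> \<mu>\<^sub>P / C\<^sub>P"
proof -
  have "\<mu> / L * (pwidth A / diameter P)\<^sup>2 = (\<mu> * (pwidth A)\<^sup>2) / (L * (diameter P)\<^sup>2)"
    by (simp add: power_divide)
  also have "\<dots> \<le> \<mu>\<^sub>P / C\<^sub>P"
    using geometric_ge curvature_le curvature_pos geometric_pos by (intro frac_le) auto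
  finally show ?thesis .
qed

lemma ratio_lower_pos: "0 < \<mu> / L * (pwidth A / diameter P)\<^sup>2"
  using \<mu>_pos L_pos pwidth_pos[OF finite_A card_A] diameter_pos by simp

subsection \<open>One Frank--Wolfe step\<close>

text \<open>If the slope in direction \<open>N - M\<close> were \<open>-h < 0\<close>, the quadratic upper bound would make \<open>f\<close> drop by at least
  \<open>t * h / 2\<close> for small \<open>t > 0\<close>.\<close>
lemma first_order_optimality:
  assumes M: "M \<in> P" and N: "N \<in> P"
    and opt: "\<And>t. 0 < t \<Longrightarrow> t \<le> 1 \<Longrightarrow> f M \<le> f (M + t *\<^sub>R (N - M))"
  shows "0 \<le> blinfun_apply (D M) (N - M)"
proof (rule ccontr)
  let ?h = "- blinfun_apply (D M) (N - M)" and ?b = "L * (norm (N - M))\<^sup>2"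
  assume "\<not> 0 \<le> blinfun_apply (D M) (N - M)"
  then have h: "0 < ?h" by simp
  then have "N \<noteq> M" by auto
  then have b: "0 < ?b" using L_pos by simp
  define t where "t = min 1 (?h / ?b)"
  have t: "0 < t" "t \<le> 1" "t * ?b \<le> ?h"
  proof -
    show "0 < t" "t \<le> 1" using divide_pos_pos[OF h b] by (auto simp: t_def)
    have "t \<le> ?h / ?b" by (simp add: t_def)
    then show "t * ?b \<le> ?h" using b by (simp only: pos_le_divide_eq)
  qed
  have "f (M + t *\<^sub>R (N - M)) - f M + t * ?h \<le> L / 2 * (t * norm (N - M))\<^sup>2"
    using bregman_upper[OF M segment_in_P[OF M N, of t]] t by (simp add: blinfun.scaleR_right)
  also have "\<dots> = t / 2 * (t * ?b)" by (simp add: power2_eq_square)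
  also have "\<dots> \<le> t / 2 * ?h" using t by (intro mult_left_mono) auto
  finally have "t * ?h \<le> t / 2 * ?h" using opt[OF t(1,2)] by linarith
  with t(1) h show False by simp
qed

text \<open>The nonnegative numbers \<open>D M (y - M)\<close> have average \<open>0\<close> under the positive weights that
  represent \<open>M\<close>, so all of them vanish.\<close>
lemma constant_on_active_set:
  assumes S: "S \<in> active_sets A M" and ge: "\<forall>y\<in>S. 0 \<le> blinfun_apply (D M) (y - M)" and y: "y \<in> S"
  shows "blinfun_apply (D M) y = blinfun_apply (D M) M"
proof -
  let ?g = "blinfun_apply (D M)"
  obtain w where w: "\<forall>n\<in>S. 0 < w n" "(\<Sum>n\<in>S. w n) = 1" "M = (\<Sum>n\<in>S. w n *\<^sub>R n)"
    and fin: "finite S"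
    using S by (auto simp: active_sets_def)
  have "(\<Sum>n\<in>S. w n * ?g (n - M)) = (\<Sum>n\<in>S. w n * ?g n) - (\<Sum>n\<in>S. w n) * ?g M"
    by (simp add: blinfun.diff_right right_diff_distrib sum_subtractf sum_distrib_right)
  also have "(\<Sum>n\<in>S. w n * ?g n) = ?g M"
    by (subst (2) w(3)) (simp add: linear_sum[OF linear_D] blinfun.scaleR_right)
  finally have "(\<Sum>n\<in>S. w n * ?g (n - M)) = 0" using w(2) by simp
  moreover have "\<forall>n\<in>S. 0 \<le> w n * ?g (n - M)" using w(1) ge by (simp add: less_imp_le)
  ultimately have "w y * ?g (y - M) = 0" using fin y by (simp add: sum_nonneg_eq_0_iff)
  then show ?thesis using w(1) y by (auto simp: blinfun.diff_right)
qed

text \<open>Every active set has a point on which \<open>D M\<close> is at least \<open>D M M\<close>, and \<open>S\<close> shows that the away vertex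
  does no better; so the denominator of \<open>step_ratio\<close> is minus the Frank--Wolfe gap \<open>h\<close>. With
  \<open>\<rho> = step_ratio A D M N\<close>, geometric strong convexity reads
  \<open>f M - f N \<le> \<rho> * h - \<rho>\<^sup>2 / 2 * \<mu>\<^sub>P\<close>, and the second bound is the maximum of the right-hand
  side over \<open>\<rho>\<close>.\<close>
lemma gap_bound:
  assumes S: "S \<in> active_sets A M" and const: "\<forall>y\<in>S. blinfun_apply (D M) y = blinfun_apply (D M) M"
    and s: "s \<in> A" "\<forall>y\<in>A. blinfun_apply (D M) s \<le> blinfun_apply (D M) y"
    and N: "N \<in> P" "f N < f M"
  shows "f M - f N \<le> blinfun_apply (D M) (M - s)"
    "f M - f N \<le> (blinfun_apply (D M) (M - s))\<^sup>2 / (2 * \<mu>\<^sub>P)"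
proof -
  let ?g = "blinfun_apply (D M)" and ?\<rho> = "step_ratio A D M N"
  let ?h = "?g (M - s)"
  have M: "M \<in> P" using active_sets_in_hull[OF S] .
  have "?g s \<le> ?g N" using linear_ge_on_convex_hull[OF linear_D s(2) N(1)] .
  then show le: "f M - f N \<le> ?h" using tangent_below[OF M N(1)] by (simp add: blinfun.diff_right)
  obtain a n T where a: "a \<in> A" "\<forall>y\<in>A. ?g a \<le> ?g y"
    and T: "T \<in> active_sets A M" "n \<in> T" "\<forall>y\<in>T. ?g y \<le> ?g n"
      "\<And>T. T \<in> active_sets A M \<Longrightarrow> \<exists>y\<in>T. ?g n \<le> ?g y"
    and ratio: "\<And>M'. step_ratio A D M M' = ?g (M' - M) / ?g (a - n)"
    using step_ratio_vertices[OF finite_A M, of D] by metis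
  have "?g a = ?g s" using a s by (simp add: order_antisym)
  moreover have "?g n = ?g M"
  proof (rule order_antisym)
    show "?g n \<le> ?g M" using T(4)[OF S] const by auto
    show "?g M \<le> ?g n"
      using linear_le_on_convex_hull[OF linear_D T(3)] active_setsD(4)[OF T(1)] .
  qed
  ultimately have an: "?g (a - n) = - ?h" by (simp add: blinfun.diff_right)
  have neg: "?g (N - M) < 0" using tangent_below[OF M N(1)] N(2) by simp
  have h: "0 < ?h" using le N(2) by simp
  have gN: "?g (N - M) = - (?\<rho> * ?h)" using h by (simp add: ratio an)
  have "?\<rho>\<^sup>2 / 2 * \<mu>\<^sub>P \<le> f N - f M + ?\<rho> * ?h"
    using geometric_bound[OF M N(1) neg] gN by simp
  moreover have "?\<rho> * ?h - ?\<rho>\<^sup>2 / 2 * \<mu>\<^sub>P \<le> ?h\<^sup>2 / (2 * \<mu>\<^sub>P)"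
  proof -
    have "?h\<^sup>2 / (2 * \<mu>\<^sub>P) - (?\<rho> * ?h - ?\<rho>\<^sup>2 / 2 * \<mu>\<^sub>P) = (?h - ?\<rho> * \<mu>\<^sub>P)\<^sup>2 / (2 * \<mu>\<^sub>P)"
      using geometric_pos by (simp add: field_simps power2_eq_square)
    also have "\<dots> \<ge> 0" using geometric_pos by simp
    finally show ?thesis by simp
  qed
  ultimately show "f M - f N \<le> ?h\<^sup>2 / (2 * \<mu>\<^sub>P)" by linarith
qed

text \<open>The step length \<open>min 1 (h / C\<^sub>P)\<close> minimizes the quadratic model \<open>f M - t * h + t\<^sup>2 / 2 * C\<^sub>P\<close> on
  \<open>[0, 1]\<close>. An interior minimum gains the fraction \<open>\<mu>\<^sub>P / C\<^sub>P\<close> of the optimality gap, a full step at least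
  half of it.\<close>
lemma frank_wolfe_step_contracts:
  assumes S: "S \<in> active_sets A M" and const: "\<forall>y\<in>S. blinfun_apply (D M) y = blinfun_apply (D M) M"
    and s: "s \<in> A" "\<forall>y\<in>A. blinfun_apply (D M) s \<le> blinfun_apply (D M) y"
    and N: "N \<in> P" "f N \<le> f M"
  obtains t where "0 \<le> t" "t \<le> 1"
    "f (M + t *\<^sub>R (s - M)) - f N \<le> (1 - min (1 / 2) (\<mu>\<^sub>P / C\<^sub>P)) * (f M - f N)"
proof (cases "f N = f M")
  case True
  with that[of 0] show ?thesis by simp
next
  case False
  let ?h = "blinfun_apply (D M) (M - s)" and ?m = "min (1 / 2) (\<mu>\<^sub>P / C\<^sub>P)"
  have lt: "f N < f M" using False N by simp
  note gap = gap_bound[OF S const s N(1) lt]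
  have h: "0 < ?h" using gap(1) lt by simp
  have C: "0 < C\<^sub>P" by (rule curvature_pos)
  have M: "M \<in> P" "s \<in> P" using active_sets_in_hull[OF S] s(1) by (auto simp: hull_inc)
  have gs: "blinfun_apply (D M) (s - M) = - ?h" by (simp add: blinfun.diff_right)
  have "?m * (f M - f N) \<le> f M - f (M + t *\<^sub>R (s - M))" if t: "t = min 1 (?h / C\<^sub>P)" for t
  proof (cases "?h \<le> C\<^sub>P")
    case True
    then have t': "t = ?h / C\<^sub>P" using C by (simp add: t)
    have "?m * (f M - f N) \<le> \<mu>\<^sub>P / C\<^sub>P * (?h\<^sup>2 / (2 * \<mu>\<^sub>P))"
      using gap(2) lt geometric_pos C by (intro mult_mono) auto
    also have "\<dots> = ?h\<^sup>2 / (2 * C\<^sub>P)" using geometric_pos by simp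
    also have "\<dots> = t * ?h - t\<^sup>2 / 2 * C\<^sub>P" using C by (simp add: t' field_simps power2_eq_square)
    also have "\<dots> \<le> f M - f (M + t *\<^sub>R (s - M))"
      using curvature_bound[OF M, of t] True h C by (simp add: gs t')
    finally show ?thesis .
  next
    case False
    then have t': "t = 1" using C by (simp add: t)
    have "?m * (f M - f N) \<le> 1 / 2 * ?h"
      using gap(1) lt h by (intro mult_mono min.cobounded1) auto
    also have "\<dots> \<le> ?h - 1 / 2 * C\<^sub>P" using False by simp
    also have "\<dots> \<le> f M - f (M + t *\<^sub>R (s - M))"
      using curvature_bound[OF M, of 1] by (simp add: gs t')
    finally show ?thesis .
  qed
  then have "f (M + min 1 (?h / C\<^sub>P) *\<^sub>R (s - M)) - f N \<le> (1 - ?m) * (f M - f N)"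
    by (simp add: left_diff_distrib)
  then show ?thesis using h C by (intro that[of "min 1 (?h / C\<^sub>P)"]) auto
qed

end

section \<open>Information matrices of designs\<close>

text \<open>The integral is the sum of the finitely many values, weighted by the probabilities of their
  fibres.\<close>
lemma (in prob_space) integral_in_convex_hull_of_finite_range:
  fixes f :: "'a \<Rightarrow> 'b::euclidean_space"
  assumes f: "f \<in> borel_measurable M" and B: "finite B" and range: "AE x in M. f x \<in> B"
  shows "(\<integral>x. f x \<partial>M) \<in> convex hull B"
proof -
  define E where "E b = f -` {b} \<inter> space M" for b
  have E: "E b \<in> sets M" for b unfolding E_def using f by (rule measurable_sets) simp
  have ind: "integrable M (\<lambda>x. indicator (E b) x :: real)" for b
    using E by (simp add: integrable_indicator_iff emeasure_eq_measure)
  have sum_ind: "(\<Sum>b\<in>B. indicator (E b) x *\<^sub>R c b) = c (f x)"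
    if "x \<in> space M" "f x \<in> B" for x and c :: "'b \<Rightarrow> 'c::real_vector"
  proof -
    have "(\<Sum>b\<in>B. indicator (E b) x *\<^sub>R c b) = (\<Sum>b\<in>B. if b = f x then c b else 0)"
      using that(1) by (intro sum.cong) (auto simp: E_def indicator_def)
    also have "\<dots> = c (f x)" using B that(2) by simp
    finally show ?thesis .
  qed
  have "(\<integral>x. f x \<partial>M) = (\<integral>x. (\<Sum>b\<in>B. indicator (E b) x *\<^sub>R b) \<partial>M)"
    using range f E AE_space
    by (intro integral_cong_AE) (auto simp: sum_ind elim: eventually_elim2 intro!: borel_measurable_sum borel_measurable_scaleR)
  also have "\<dots> = (\<Sum>b\<in>B. prob (E b) *\<^sub>R b)"
    using ind E by (simp add: Bochner_Integration.integral_sum)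
  finally have int: "(\<integral>x. f x \<partial>M) = (\<Sum>b\<in>B. prob (E b) *\<^sub>R b)" .
  have "(\<Sum>b\<in>B. prob (E b)) = (\<integral>x. (\<Sum>b\<in>B. indicator (E b) x *\<^sub>R 1) \<partial>M)"
    using ind E by (simp add: Bochner_Integration.integral_sum)
  also have "\<dots> = (\<integral>x. 1 \<partial>M)"
    using range f E AE_space
    by (intro integral_cong_AE) (auto simp del: scaleR_one real_scaleR_def simp: sum_ind elim: eventually_elim2 intro!: borel_measurable_sum borel_measurable_scaleR)
  also have "\<dots> = (1::real)" by (simp add: prob_space)
  finally have "(\<Sum>b\<in>B. prob (E b)) = 1" .
  with int show ?thesis
    unfolding convex_hull_finite[OF B] by (intro CollectI exI[of _ "\<lambda>b. prob (E b)"]) auto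
qed

lemma designsD:
  assumes "\<xi> \<in> designs X"
  shows "prob_space \<xi>" "space \<xi> = X" "sets \<xi> = sets (restrict_space borel X)"
proof -
  show *: "prob_space \<xi>" "sets \<xi> = sets (restrict_space borel X)" using assms by (auto simp: designs_def)
  show "space \<xi> = X" using sets_eq_imp_space_eq[OF *(2)] by (simp add: space_restrict_space)
qed

lemma open_Int_in_sets_design:
  assumes "\<xi> \<in> designs X" "open U"
  shows "U \<inter> X \<in> sets \<xi>"
  using assms by (auto simp: designsD sets_restrict_space)

lemma closed_Int_in_sets_design:
  assumes "\<xi> \<in> designs X" "closed U"
  shows "U \<inter> X \<in> sets \<xi>"
  using assms by (auto simp: designsD sets_restrict_space)

lemma measurable_on_design:
  assumes "\<xi> \<in> designs X" "continuous_on X m"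
  shows "m \<in> borel_measurable \<xi>"
  using borel_measurable_continuous_on_restrict[OF assms(2)] designsD(3)[OF assms(1)]
  by (simp cong: measurable_cong_sets)

text \<open>The complement of the support is covered by open null sets, but an arbitrary such cover need not be
  countable. It is exhausted by the compact sets \<open>K n\<close> of points at distance at least \<open>1 / (n + 1)\<close> from
  the support, and each of these is covered by finitely many null sets.\<close>
lemma AE_in_finite_design_support:
  assumes X: "compact X" and \<xi>: "\<xi> \<in> designs X" and fin: "finite (design_support \<xi>)"
  shows "AE x in \<xi>. x \<in> design_support \<xi>"
proof -
  note D = designsD[OF \<xi>]
  define K where "K n = X - (\<Union>y\<in>design_support \<xi>. ball y (1 / Suc n))" for n
  have K_compact: "compact (K n)" for n
    unfolding K_def using X by (intro compact_diff open_UN ballI open_ball)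
  have K_null: "K n \<in> null_sets \<xi>" for n
  proof -
    have "\<exists>U. open U \<and> x \<in> U \<and> emeasure \<xi> (U \<inter> X) = 0" if "x \<in> K n" for x
    proof -
      have "x \<in> X" "x \<notin> design_support \<xi>" using that by (auto simp: K_def)
      then show ?thesis by (auto simp: design_support_def D(2))
    qed
    then obtain U where U: "\<And>x. x \<in> K n \<Longrightarrow> open (U x) \<and> x \<in> U x \<and> emeasure \<xi> (U x \<inter> X) = 0"
      by metis
    obtain C where C: "C \<subseteq> K n" "finite C" "K n \<subseteq> (\<Union>x\<in>C. U x)"
      using compactE_image[OF K_compact, of "K n" U n] U by blast
    have "(\<Union>x\<in>C. U x \<inter> X) \<in> null_sets \<xi>"
      using C U open_Int_in_sets_design[OF \<xi>] by (intro null_sets_UN') (auto simp: countable_finite null_sets_def)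
    moreover have "K n \<in> sets \<xi>"
      using closed_Int_in_sets_design[OF \<xi> compact_imp_closed[OF K_compact[of n]]]
      by (simp add: K_def Int_absorb2 Diff_subset)
    moreover have "K n \<subseteq> (\<Union>x\<in>C. U x \<inter> X)" using C(3) by (auto simp: K_def)
    ultimately show ?thesis by (rule null_sets_subset)
  qed
  have "AE x in \<xi>. \<forall>n. x \<notin> K n"
    using K_null by (simp add: AE_all_countable AE_not_in)
  then show ?thesis
    using AE_space
  proof eventually_elim
    case (elim x)
    show ?case
    proof (rule ccontr)
      assume x: "x \<notin> design_support \<xi>"
      have "open (- design_support \<xi>)" using fin by (simp add: finite_imp_closed open_Compl)
      then obtain e where e: "0 < e" "ball x e \<subseteq> - design_support \<xi>"
        using x by (auto simp: open_contains_ball)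
      obtain n where n: "1 / Suc n < e" using nat_approx_posE[OF e(1)] by blast
      have "x \<in> K n" using e n elim(2) by (force simp: K_def D(2) dist_commute)
      with elim(1) show False by blast
    qed
  qed
qed

lemma info_matrix_in_hull_of_support:
  fixes m :: "'x::metric_space \<Rightarrow> real ^ 'd ^ 'd"
  assumes "compact X" "continuous_on X m" and \<xi>: "\<xi> \<in> designs X" and fin: "finite (design_support \<xi>)"
  shows "info_matrix m \<xi> \<in> convex hull (m ` design_support \<xi>)"
proof -
  interpret prob_space \<xi> using designsD(1)[OF \<xi>] .
  have "AE x in \<xi>. m x \<in> m ` design_support \<xi>"
    using AE_in_finite_design_support[OF assms(1) \<xi> fin] by (rule eventually_mono) auto
  then show ?thesis
    unfolding info_matrix_def using fin measurable_on_design[OF \<xi> assms(2)]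
    by (intro integral_in_convex_hull_of_finite_range) auto
qed

lemma info_matrix_in_hull:
  fixes m :: "'x::metric_space \<Rightarrow> real ^ 'd ^ 'd"
  assumes "continuous_on X m" "finite (m ` X)" and \<xi>: "\<xi> \<in> designs X"
  shows "info_matrix m \<xi> \<in> convex hull (m ` X)"
proof -
  interpret prob_space \<xi> using designsD(1)[OF \<xi>] .
  have "AE x in \<xi>. m x \<in> m ` X"
    using AE_space by (rule eventually_mono) (auto simp: designsD(2)[OF \<xi>])
  then show ?thesis
    unfolding info_matrix_def using assms measurable_on_design[OF \<xi> assms(1)]
    by (intro integral_in_convex_hull_of_finite_range) auto
qed

text \<open>Different points of \<open>Y\<close> may have the same image, so the weight of an image point is placed on a
  single representative, chosen in a subset \<open>Z\<close> on which \<open>f\<close> is injective.\<close>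
lemma convex_combination_pmf:
  fixes f :: "'x \<Rightarrow> 'b::euclidean_space"
  assumes Y: "finite Y" and N: "N \<in> convex hull (f ` Y)"
  obtains p where "set_pmf p \<subseteq> Y" "N = (\<integral>x. f x \<partial>measure_pmf p)"
proof -
  obtain Z where Z: "Z \<subseteq> Y" "inj_on f Z" "f ` Z = f ` Y"
    using subset_image_inj[of "f ` Y" f Y] by auto
  have fZ: "finite Z" using Z(1) Y finite_subset by blast
  have "N \<in> convex hull (f ` Z)" using N Z(3) by simp
  then obtain u where u: "\<And>b. b \<in> f ` Z \<Longrightarrow> 0 \<le> u b" "sum u (f ` Z) = 1" "(\<Sum>b\<in>f ` Z. u b *\<^sub>R b) = N"
    using convex_hull_finite[of "f ` Z"] fZ by auto
  define w where "w z = (if z \<in> Z then u (f z) else 0)" for z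
  have nonneg: "0 \<le> w z" for z using u(1) by (simp add: w_def)
  have "(\<integral>\<^sup>+ z. ennreal (w z) \<partial>count_space UNIV) = (\<Sum>z\<in>Z. ennreal (w z))"
    using fZ by (intro nn_integral_count_space'[THEN trans]) (auto simp: w_def)
  also have "\<dots> = ennreal (\<Sum>z\<in>Z. w z)" using nonneg by (rule sum_ennreal)
  also have "(\<Sum>z\<in>Z. w z) = 1" using u(2) Z(2) by (simp add: w_def sum.reindex)
  finally have one: "(\<integral>\<^sup>+ z. ennreal (w z) \<partial>count_space UNIV) = 1" by simp
  define p where "p = embed_pmf w"
  have pmf: "pmf p z = w z" for z unfolding p_def by (rule pmf_embed_pmf[OF nonneg one])
  have supp: "set_pmf p \<subseteq> Z" by (auto simp: set_pmf_eq pmf w_def split: if_splits)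
  have "(\<integral>x. f x \<partial>measure_pmf p) = (\<Sum>z\<in>Z. pmf p z *\<^sub>R f z)"
    using fZ supp by (intro integral_measure_pmf) auto
  also have "\<dots> = N" using u(3) Z(2) by (simp add: pmf w_def sum.reindex)
  finally show ?thesis using that[of p] supp Z(1) by auto
qed

lemma hull_is_info_matrix:
  fixes m :: "'x::metric_space \<Rightarrow> real ^ 'd ^ 'd"
  assumes m: "continuous_on X m" and Y: "finite Y" "Y \<subseteq> X" and N: "N \<in> convex hull (m ` Y)"
  obtains \<eta> where "\<eta> \<in> designs_in X Y" "info_matrix m \<eta> = N"
proof -
  obtain p where p: "set_pmf p \<subseteq> Y" "N = (\<integral>x. m x \<partial>measure_pmf p)"
    using convex_combination_pmf[OF Y(1) N] .
  let ?R = "restrict_space borel X"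
  obtain x0 where "x0 \<in> set_pmf p" using set_pmf_not_empty[of p] by blast
  then have x0: "x0 \<in> X" using p Y by blast
  \<comment> \<open>The measurable map below has to send all of the type into \<open>X\<close>; off the support of \<open>p\<close> its
    values do not affect the image measure.\<close>
  define h where "h x = (if x \<in> X then x else x0)" for x
  define \<eta> where "\<eta> = distr (measure_pmf p) ?R h"
  have h: "h \<in> measurable (measure_pmf p) ?R"
    using x0 by (auto simp: measurable_def h_def space_restrict_space)
  have h_id: "AE x in measure_pmf p. h x = x"
    using p Y by (auto simp: AE_measure_pmf_iff h_def)
  have \<eta>: "\<eta> \<in> designs X"
    using prob_space.prob_space_distr[OF _ h] prob_space_measure_pmf[of p] by (simp add: designs_def \<eta>_def)
  have "design_support \<eta> \<subseteq> Y"
  proof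
    fix y assume y: "y \<in> design_support \<eta>"
    show "y \<in> Y"
    proof (rule ccontr)
      assume "y \<notin> Y"
      moreover have "open (- Y)" using Y(1) by (simp add: finite_imp_closed open_Compl)
      ultimately have pos: "0 < emeasure \<eta> (- Y \<inter> space \<eta>)" using y by (auto simp: design_support_def)
      have "emeasure \<eta> (- Y \<inter> space \<eta>) = emeasure (measure_pmf p) (h -` (- Y \<inter> X) \<inter> space (measure_pmf p))"
        unfolding designsD(2)[OF \<eta>] unfolding \<eta>_def
        using h open_Int_in_sets_design[OF \<eta> \<open>open (- Y)\<close>] \<eta>
        by (intro emeasure_distr) (auto simp: designsD(3))
      also have "\<dots> = 0"
      proof -
        have "h z \<in> Y" if "z \<in> set_pmf p" for z
          using that p(1) Y(2) unfolding h_def by (metis subsetD)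
        then have "set_pmf p \<inter> h -` (- Y \<inter> X) = {}" by blast
        then show ?thesis
          by (simp add: measure_pmf.emeasure_eq_measure measure_pmf_zero_iff del: vimage_Int vimage_Compl)
      qed
      finally show False using pos by simp
    qed
  qed
  moreover have "info_matrix m \<eta> = (\<integral>x. m (h x) \<partial>measure_pmf p)"
    unfolding info_matrix_def \<eta>_def
    by (rule integral_distr[OF h borel_measurable_continuous_on_restrict[OF m]])
  moreover have "(\<integral>x. m (h x) \<partial>measure_pmf p) = N"
    unfolding p(2) using h_id by (intro integral_cong_AE) (auto elim: eventually_mono)
  ultimately show ?thesis using that \<eta> by (auto simp: designs_in_def)
qed

lemma info_matrices_eq_hull:
  fixes m :: "'x::metric_space \<Rightarrow> real ^ 'd ^ 'd"
  assumes m: "continuous_on X m" and A: "finite (m ` X)"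
  shows "info_matrix m ` designs X = convex hull (m ` X)"
proof
  show "info_matrix m ` designs X \<subseteq> convex hull (m ` X)"
    using info_matrix_in_hull[OF m A] by blast
  show "convex hull (m ` X) \<subseteq> info_matrix m ` designs X"
  proof
    fix N assume N: "N \<in> convex hull (m ` X)"
    obtain Y where Y: "Y \<subseteq> X" "finite Y" "m ` X = m ` Y"
      using finite_subset_image[OF A, of m X] by auto
    then obtain \<eta> where "\<eta> \<in> designs_in X Y" "info_matrix m \<eta> = N"
      using hull_is_info_matrix[OF m, of Y N] N by metis
    then show "N \<in> info_matrix m ` designs X" by (auto simp: designs_in_def)
  qed
qed

section \<open>The strict algorithms\<close>

text \<open>What the two algorithms have in common suffices for the rate: the next discretization contains
  the support of the current design and the new point, and adds no other point than the new one to the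
  current discretization.\<close>
lemma exact_strict_algorithmD:
  assumes alg: "strict_algorithm upd_without_exchange X m \<Psi> D X0 \<epsilon> \<delta>1 \<delta>2 K Xs \<xi> x
       \<or> strict_algorithm upd_with_exchange X m \<Psi> D X0 \<epsilon> \<delta>1 \<delta>2 K Xs \<xi> x"
    and \<delta>: "\<forall>k. \<delta>1 k = 0" "\<forall>k. \<delta>2 k = 0"
  shows "\<And>k. Suc k \<in> K \<Longrightarrow> k \<in> K"
    and "Xs 0 = X0"
    and "\<And>k. Suc k \<in> K \<Longrightarrow> design_support (\<xi> k) \<union> {x k} \<subseteq> Xs (Suc k)"
    and "\<And>k. Suc k \<in> K \<Longrightarrow> Xs (Suc k) \<subseteq> Xs k \<union> {x k}"
    and "\<And>k. k \<in> K \<Longrightarrow> \<xi> k \<in> designs_in X (Xs k)"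
    and "\<And>k \<eta>. k \<in> K \<Longrightarrow> \<eta> \<in> designs_in X (Xs k) \<Longrightarrow> \<Psi> (info_matrix m (\<xi> k)) \<le> \<Psi> (info_matrix m \<eta>)"
    and "\<And>k. k \<in> K \<Longrightarrow> x k \<in> X"
    and "\<And>k y. k \<in> K \<Longrightarrow> y \<in> X \<Longrightarrow>
      sensitivity D m (info_matrix m (\<xi> k)) (x k) \<le> sensitivity D m (info_matrix m (\<xi> k)) y"
proof -
  show down: "k \<in> K" if "Suc k \<in> K" for k
    using alg that by (auto simp: strict_algorithm_def Let_def)
  show "Xs 0 = X0" using alg by (auto simp: strict_algorithm_def Let_def)
  have sol1: "approx_solution 0 (designs_in X (Xs k)) (\<lambda>\<eta>. \<Psi> (info_matrix m \<eta>)) (\<xi> k)"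
    and sol2: "approx_solution 0 X (\<lambda>y. ereal (sensitivity D m (info_matrix m (\<xi> k)) y)) (x k)"
    if "k \<in> K" for k
    using alg that \<delta> by (auto simp: strict_algorithm_def Let_def)
  show in_Xs: "\<xi> k \<in> designs_in X (Xs k)" if "k \<in> K" for k
    using sol1[OF that] by (simp add: approx_solution_def)
  show "\<Psi> (info_matrix m (\<xi> k)) \<le> \<Psi> (info_matrix m \<eta>)" if "k \<in> K" "\<eta> \<in> designs_in X (Xs k)" for k \<eta>
    using sol1[OF that(1)] INF_lower[OF that(2), of "\<lambda>\<eta>. \<Psi> (info_matrix m \<eta>)"]
    by (auto simp: approx_solution_def intro: order_trans)
  show "x k \<in> X" if "k \<in> K" for k using sol2[OF that] by (simp add: approx_solution_def)
  show "sensitivity D m (info_matrix m (\<xi> k)) (x k) \<le> sensitivity D m (info_matrix m (\<xi> k)) y"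
    if "k \<in> K" "y \<in> X" for k y
  proof -
    have "ereal (sensitivity D m (info_matrix m (\<xi> k)) (x k))
        \<le> (INF y\<in>X. ereal (sensitivity D m (info_matrix m (\<xi> k)) y))"
      using sol2[OF that(1)] by (simp add: approx_solution_def)
    also have "\<dots> \<le> ereal (sensitivity D m (info_matrix m (\<xi> k)) y)" using that(2) by (rule INF_lower)
    finally show ?thesis by simp
  qed
  have upd: "Xs (Suc k) = Xs k \<union> {x k} \<or> Xs (Suc k) = design_support (\<xi> k) \<union> {x k}"
    if "Suc k \<in> K" for k
    using alg that
    by (auto simp: strict_algorithm_def Let_def upd_without_exchange_def upd_with_exchange_def)
  have supp: "design_support (\<xi> k) \<subseteq> Xs k" if "k \<in> K" for k
    using in_Xs[OF that] by (simp add: designs_in_def)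
  show "design_support (\<xi> k) \<union> {x k} \<subseteq> Xs (Suc k)" if "Suc k \<in> K" for k
    using upd[OF that] supp[OF down[OF that]] by auto
  show "Xs (Suc k) \<subseteq> Xs k \<union> {x k}" if "Suc k \<in> K" for k
    using upd[OF that] supp[OF down[OF that]] by auto
qed

text \<open>Optimality of \<open>\<xi>\<close> on \<open>Y\<close> makes the derivative constant on the atoms of \<open>\<xi>\<close>, so the Frank--Wolfe step
  towards \<open>m s\<close> contracts; its endpoint is the information matrix of a design on \<open>Y'\<close>, hence not
  better than \<open>\<xi>'\<close>.\<close>
lemma exchange_step_contracts:
  fixes m :: "'x::metric_space \<Rightarrow> real ^ 'd ^ 'd"
  assumes scp: "smooth_convex_polytope (m ` X) f D \<mu> L"
    and X: "compact X" "continuous_on X m"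
    and Y: "finite Y" "Y \<subseteq> X" and \<xi>: "\<xi> \<in> designs_in X Y"
    and opt: "\<And>\<eta>. \<eta> \<in> designs_in X Y \<Longrightarrow> f (info_matrix m \<xi>) \<le> f (info_matrix m \<eta>)"
    and s: "s \<in> X"
      "\<And>y. y \<in> X \<Longrightarrow> sensitivity D m (info_matrix m \<xi>) s \<le> sensitivity D m (info_matrix m \<xi>) y"
    and Y': "finite Y'" "Y' \<subseteq> X" "design_support \<xi> \<union> {s} \<subseteq> Y'"
    and opt': "\<And>\<eta>. \<eta> \<in> designs_in X Y' \<Longrightarrow> f (info_matrix m \<xi>') \<le> f (info_matrix m \<eta>)"
    and N: "N \<in> convex hull (m ` X)" "f N \<le> f (info_matrix m \<xi>)"
  shows "f (info_matrix m \<xi>') - f N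
    \<le> (1 - min (1 / 2) (geometric_strong_convexity (m ` X) (convex hull (m ` X)) f D
          / curvature_const (convex hull (m ` X)) f D)) * (f (info_matrix m \<xi>) - f N)"
proof -
  interpret smooth_convex_polytope "m ` X" f D \<mu> L by (rule scp)
  define M where "M = info_matrix m \<xi>"
  have \<xi>': "\<xi> \<in> designs X" and supp: "design_support \<xi> \<subseteq> Y" using \<xi> by (auto simp: designs_in_def)
  have fin: "finite (design_support \<xi>)" using supp Y(1) finite_subset by blast
  have M: "M \<in> convex hull (m ` design_support \<xi>)"
    unfolding M_def by (rule info_matrix_in_hull_of_support[OF X \<xi>' fin])
  then obtain S where S0: "S \<in> active_sets (m ` design_support \<xi>) M"
    using active_set_exists fin by blast
  then have S: "S \<in> active_sets (m ` X) M"
    using active_sets_mono[of "m ` design_support \<xi>" "m ` X"] supp Y(2) by blast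
  have MP: "M \<in> P" using active_sets_in_hull[OF S] .
  have MY: "M \<in> convex hull (m ` Y)" using M supp hull_mono[of "m ` design_support \<xi>" "m ` Y"] by blast
  have "0 \<le> blinfun_apply (D M) (y - M)" if y: "y \<in> S" for y
  proof (rule first_order_optimality[OF MP])
    have yY: "y \<in> m ` Y" using y active_setsD(1)[OF S0] supp by blast
    then show "y \<in> P" using Y(2) by (blast intro: hull_inc)
    fix t :: real assume t: "0 < t" "t \<le> 1"
    have "M + t *\<^sub>R (y - M) \<in> convex hull (m ` Y)"
      using convexD_alt[OF convex_convex_hull MY hull_inc[OF yY], of t] t by (simp add: algebra_simps)
    then obtain \<eta> where "\<eta> \<in> designs_in X Y" "info_matrix m \<eta> = M + t *\<^sub>R (y - M)"
      using hull_is_info_matrix[OF X(2) Y] by metis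
    with opt show "f M \<le> f (M + t *\<^sub>R (y - M))" by (metis M_def)
  qed
  then have const: "\<forall>y\<in>S. blinfun_apply (D M) y = blinfun_apply (D M) M"
    using constant_on_active_set[OF S] by blast
  have toward: "\<forall>y\<in>m ` X. blinfun_apply (D M) (m s) \<le> blinfun_apply (D M) y"
    using s(2) by (auto simp: sensitivity_def blinfun.diff_right M_def)
  obtain t where t: "0 \<le> t" "t \<le> 1"
    "f (M + t *\<^sub>R (m s - M)) - f N \<le> (1 - min (1 / 2) (\<mu>\<^sub>P / C\<^sub>P)) * (f M - f N)"
    using frank_wolfe_step_contracts[OF S const _ toward N(1)] N(2) s(1) unfolding M_def by blast
  have "M \<in> convex hull (m ` Y')"
    using M Y'(3) hull_mono[of "m ` design_support \<xi>" "m ` Y'"] by blast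
  moreover have "m s \<in> convex hull (m ` Y')" using Y'(3) by (simp add: hull_inc)
  ultimately have "M + t *\<^sub>R (m s - M) \<in> convex hull (m ` Y')"
    using convexD_alt[OF convex_convex_hull, of M "m ` Y'" "m s" t] t by (simp add: algebra_simps)
  then obtain \<eta> where "\<eta> \<in> designs_in X Y'" "info_matrix m \<eta> = M + t *\<^sub>R (m s - M)"
    using hull_is_info_matrix[OF X(2) Y'(1,2)] by metis
  with opt' have "f (info_matrix m \<xi>') \<le> f (M + t *\<^sub>R (m s - M))" by metis
  with t(3) show ?thesis by (simp add: M_def)
qed

theorem theorem3p22:
  fixes X :: "'x::metric_space set"
    and m :: "'x \<Rightarrow> real ^ 'd ^ 'd"
    and \<Psi> :: "real ^ 'd ^ 'd \<Rightarrow> ereal"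
    and U :: "(real ^ 'd ^ 'd) set"
    and \<Psi>ext :: "real ^ 'd ^ 'd \<Rightarrow> real"
    and D\<Psi> :: "real ^ 'd ^ 'd \<Rightarrow> (real ^ 'd ^ 'd) \<Rightarrow>\<^sub>L real"
    and \<mu> L \<epsilon> :: real
    and X0 :: "'x set"
    and \<delta>1 \<delta>2 :: "nat \<Rightarrow> real"
    and K :: "nat set"
    and Xs :: "nat \<Rightarrow> 'x set"
    and \<xi> :: "nat \<Rightarrow> 'x measure"
    and x :: "nat \<Rightarrow> 'x"
  defines "dom\<Psi> \<equiv> eff_dom psd_matrices \<Psi>"
    and "\<Psi>r \<equiv> (\<lambda>M. real_of_ereal (\<Psi> M))"
    and "A \<equiv> m ` X"
    and "MM \<equiv> info_matrix m ` designs X"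
    and "\<Psi>min \<equiv> (INF \<eta>\<in>designs X. \<Psi> (info_matrix m \<eta>))"
  defines "r \<equiv> 1 - min (1 / 2) (geometric_strong_convexity A MM \<Psi>r D\<Psi> / curvature_const MM \<Psi>r D\<Psi>)"
  assumes "compact X"
    and "continuous_on X m" and "m ` X \<subseteq> psd_matrices"
    and "\<forall>M\<in>psd_matrices. \<Psi> M \<noteq> - \<infinity>"
    and "ereal_convex_on psd_matrices \<Psi>" and "lsc_on psd_matrices \<Psi>"
    and "fin_designs_in m \<Psi> X X \<noteq> {}"
    and "C1_extension dom\<Psi> \<Psi>r U \<Psi>ext D\<Psi>"
    and "directionally_open dom\<Psi> MM"
    and "finite A" and "card A \<ge> 2"
    and "MM \<subseteq> dom\<Psi>"
    and "0 < \<mu>" and "strongly_convex_wrt MM \<Psi>r D\<Psi> \<mu>"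
    and "0 < L" and "smooth_wrt MM \<Psi>r D\<Psi> L"
    and "finite X0" and "X0 \<subseteq> X" and "fin_designs_in m \<Psi> X X0 \<noteq> {}"
    and "0 \<le> \<epsilon>" and "\<forall>k. \<delta>1 k = 0" and "\<forall>k. \<delta>2 k = 0"
    and "strict_algorithm upd_without_exchange X m \<Psi> D\<Psi> X0 \<epsilon> \<delta>1 \<delta>2 K Xs \<xi> x
       \<or> strict_algorithm upd_with_exchange X m \<Psi> D\<Psi> X0 \<epsilon> \<delta>1 \<delta>2 K Xs \<xi> x"
  shows "(\<exists>\<eta>\<in>designs X. \<Psi> (info_matrix m \<eta>) = \<Psi>min)
    \<and> (\<forall>k\<in>K. \<Psi> (info_matrix m (\<xi> k)) - \<Psi>min
               \<le> ereal (r ^ k) * (\<Psi> (info_matrix m (\<xi> 0)) - \<Psi>min))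
    \<and> 1 / 2 \<le> r
    \<and> r \<le> 1 - min (1 / 2) (\<mu> / L * (pwidth A / diameter MM)\<^sup>2)
    \<and> 1 - min (1 / 2) (\<mu> / L * (pwidth A / diameter MM)\<^sup>2) < 1"
proof -
  have X: "compact X" "continuous_on X m" by fact+
  have A: "finite (m ` X)" "2 \<le> card (m ` X)"
    using \<open>finite A\<close> \<open>card A \<ge> 2\<close> by (auto simp: A_def)
  have MM: "MM = convex hull A"
    unfolding MM_def A_def by (rule info_matrices_eq_hull[OF X(2) A(1)])
  have scp: "smooth_convex_polytope (m ` X) \<Psi>r D\<Psi> \<mu> L"
    using A \<open>0 < \<mu>\<close> \<open>0 < L\<close> \<open>strongly_convex_wrt MM \<Psi>r D\<Psi> \<mu>\<close> \<open>smooth_wrt MM \<Psi>r D\<Psi> L\<close>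
    unfolding MM A_def by unfold_locales
  interpret smooth_convex_polytope A \<Psi>r D\<Psi> \<mu> L using scp unfolding A_def .
  have r: "r = 1 - min (1 / 2) (\<mu>\<^sub>P / C\<^sub>P)" unfolding r_def MM ..
  have r_half: "1 / 2 \<le> r" unfolding r using min.cobounded1[of "1 / 2" "\<mu>\<^sub>P / C\<^sub>P"] by linarith
  have \<Psi>_real: "\<Psi> N = ereal (\<Psi>r N)" if "N \<in> MM" for N
  proof -
    have "N \<in> eff_dom psd_matrices \<Psi>" using that \<open>MM \<subseteq> dom\<Psi>\<close> by (auto simp: dom\<Psi>_def)
    then have "\<Psi> N \<noteq> \<infinity>" "\<Psi> N \<noteq> - \<infinity>"
      using \<open>\<forall>M\<in>psd_matrices. \<Psi> M \<noteq> - \<infinity>\<close> by (auto simp: eff_dom_def)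
    then show ?thesis unfolding \<Psi>r_def by (cases "\<Psi> N") auto
  qed
  have in_MM: "info_matrix m \<eta> \<in> MM" if "\<eta> \<in> designs X" for \<eta> using that by (auto simp: MM_def)
  have "continuous_on MM \<Psi>r"
  proof -
    have ext: "open U" "dom\<Psi> \<subseteq> U" "\<forall>M\<in>dom\<Psi>. \<Psi>ext M = \<Psi>r M"
      "\<forall>M\<in>U. (\<Psi>ext has_derivative blinfun_apply (D\<Psi> M)) (at M)"
      using \<open>C1_extension dom\<Psi> \<Psi>r U \<Psi>ext D\<Psi>\<close> by (auto simp: C1_extension_def)
    have "continuous_on MM \<Psi>ext"
      using ext \<open>MM \<subseteq> dom\<Psi>\<close>
      by (intro continuous_at_imp_continuous_on ballI has_derivative_continuous) blast
    then show ?thesis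
      by (rule continuous_on_eq) (use ext(3) \<open>MM \<subseteq> dom\<Psi>\<close> in blast)
  qed
  moreover have "compact MM" unfolding MM using finite_A by (rule finite_imp_compact_convex_hull)
  moreover have "MM \<noteq> {}" unfolding MM using A by (auto simp: A_def)
  ultimately obtain N where N: "N \<in> MM" "\<And>M. M \<in> MM \<Longrightarrow> \<Psi>r N \<le> \<Psi>r M"
    using continuous_attains_inf[of MM \<Psi>r] by blast
  obtain \<eta> where \<eta>: "\<eta> \<in> designs X" "info_matrix m \<eta> = N" using N(1) by (auto simp: MM_def)
  have min: "\<Psi>min = ereal (\<Psi>r N)"
    unfolding \<Psi>min_def
  proof (rule antisym)
    show "(INF \<eta>\<in>designs X. \<Psi> (info_matrix m \<eta>)) \<le> ereal (\<Psi>r N)"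
      using \<eta> \<Psi>_real[OF N(1)] by (intro INF_lower2[OF \<eta>(1)]) auto
    show "ereal (\<Psi>r N) \<le> (INF \<eta>\<in>designs X. \<Psi> (info_matrix m \<eta>))"
      using N(2) in_MM \<Psi>_real by (intro INF_greatest) auto
  qed
  note alg = exact_strict_algorithmD[OF
      \<open>strict_algorithm upd_without_exchange X m \<Psi> D\<Psi> X0 \<epsilon> \<delta>1 \<delta>2 K Xs \<xi> x
       \<or> strict_algorithm upd_with_exchange X m \<Psi> D\<Psi> X0 \<epsilon> \<delta>1 \<delta>2 K Xs \<xi> x\<close>
      \<open>\<forall>k. \<delta>1 k = 0\<close> \<open>\<forall>k. \<delta>2 k = 0\<close>]
  have Xs: "finite (Xs k) \<and> Xs k \<subseteq> X" if "k \<in> K" for k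
    using that
  proof (induction k)
    case 0
    then show ?case using alg(2) \<open>finite X0\<close> \<open>X0 \<subseteq> X\<close> by simp
  next
    case (Suc k)
    have "finite (Xs k \<union> {x k})" "Xs k \<union> {x k} \<subseteq> X"
      using Suc.IH[OF alg(1)[OF Suc.prems]] alg(7)[OF alg(1)[OF Suc.prems]] by auto
    then show ?case using alg(4)[OF Suc.prems] by (meson finite_subset subset_trans)
  qed
  have design: "\<xi> k \<in> designs X" if "k \<in> K" for k using alg(5)[OF that] by (simp add: designs_in_def)
  have opt: "\<Psi>r (info_matrix m (\<xi> k)) \<le> \<Psi>r (info_matrix m \<zeta>)" if "k \<in> K" "\<zeta> \<in> designs_in X (Xs k)" for k \<zeta>
    using alg(6)[OF that] that \<Psi>_real[OF in_MM[OF design[OF that(1)]]] \<Psi>_real[OF in_MM, of \<zeta>]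
    by (simp add: designs_in_def)
  have rate: "\<Psi>r (info_matrix m (\<xi> k)) - \<Psi>r N \<le> r ^ k * (\<Psi>r (info_matrix m (\<xi> 0)) - \<Psi>r N)"
    if "k \<in> K" for k
    using that
  proof (induction k)
    case (Suc k)
    note k = alg(1)[OF Suc.prems]
    have "\<Psi>r (info_matrix m (\<xi> (Suc k))) - \<Psi>r N \<le> r * (\<Psi>r (info_matrix m (\<xi> k)) - \<Psi>r N)"
      unfolding r unfolding A_def
      using Xs[OF k] Xs[OF Suc.prems] N(1) N(2)[OF in_MM[OF design[OF k]]] alg(3)[OF Suc.prems]
      by (intro exchange_step_contracts[OF scp X _ _ alg(5)[OF k] opt[OF k] alg(7)[OF k] alg(8)[OF k]
            _ _ _ opt[OF Suc.prems]]) (auto simp: MM A_def)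
    also have "\<dots> \<le> r * (r ^ k * (\<Psi>r (info_matrix m (\<xi> 0)) - \<Psi>r N))"
      using Suc.IH[OF k] r_half by (intro mult_left_mono) auto
    finally show ?case by (simp add: mult.assoc)
  qed simp
  have zero: "0 \<in> K" if "k \<in> K" for k using that by (induction k) (auto dest: alg(1))
  show ?thesis
  proof (intro conjI ballI)
    show "\<exists>\<eta>\<in>designs X. \<Psi> (info_matrix m \<eta>) = \<Psi>min" using \<eta> \<Psi>_real[OF N(1)] min by auto
    show "\<Psi> (info_matrix m (\<xi> k)) - \<Psi>min \<le> ereal (r ^ k) * (\<Psi> (info_matrix m (\<xi> 0)) - \<Psi>min)"
      if "k \<in> K" for k
      using rate[OF that] by (simp add: min \<Psi>_real[OF in_MM[OF design]] that zero[OF that])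
    show "1 / 2 \<le> r" by (rule r_half)
    show "r \<le> 1 - min (1 / 2) (\<mu> / L * (pwidth A / diameter MM)\<^sup>2)"
      unfolding r MM using min.mono[OF order_refl ratio_ge, of "1 / 2"] by linarith
    show "1 - min (1 / 2) (\<mu> / L * (pwidth A / diameter MM)\<^sup>2) < 1"
      unfolding MM using ratio_lower_pos by simp
  qed
qed

end
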